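(* For any helical $u\in\mathring{E}_2$ and any $\varepsilon>0$ there exists a divergence-free helical vector field $u^\varepsilon\in C_c^\infty(\mathbb{R}^2\times\mathbb{T})$ such that $\|u-u^\varepsilon\|_{L^2_{\mathrm{uloc}}}<\varepsilon$.
   Context: $\mathbb{T}=\mathbb{R}/2\pi\mathbb{Z}$; functions on $\mathbb{R}^2\times\mathbb{T}$ are identified with functions on $\mathbb{R}^3$ that are $2\pi$-periodic in $x_3$. $\|u\|_{L^2_{\mathrm{uloc}}}=\sup_{x_0\in\mathbb{R}^2\times\mathbb{T}}\|u\|_{L^2(B(x_0,1))}$. $\mathring{E}_2$ is the closure of the divergence-free compactly supported smooth vector fields on $\mathbb{R}^2\times\mathbb{T}$ in the $L^2_{\mathrm{uloc}}$ norm. Helical symmetry: $R_\theta=\begin{pmatrix}\cos\theta&\sin\theta&0\\-\sin\theta&\cos\theta&0\\0&0&1\end{pmatrix}$, $S_\theta(x)=R_\theta x+(0,0,\theta)^t$. A vector field $v$ is helical if $R_\theta(v(x))=v(S_\theta x)$ for all $x$ and all $\theta\in\mathbb{R}$; a non-smooth field is helical if it is a limit of smooth helical fields in the sense of distributions. *)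

theory Defs
  imports "HOL-Analysis.Analysis"
begin

text \<open>
  Functions on \<open>R\<^sup>2 \<times> T\<close>, \<open>T = R / 2 \<pi> Z\<close>, are represented throughout by functions on \<open>real ^ 3\<close>
  that are \<open>2 \<pi>\<close>-periodic in the third coordinate; \<open>slab\<close> is a fundamental domain (up to a null
  set), so that integrals over \<open>R\<^sup>2 \<times> T\<close> are integrals over \<open>slab\<close>.
\<close>

definition periodic3 :: "(real ^ 3 \<Rightarrow> 'b) \<Rightarrow> bool" where
  "periodic3 f \<longleftrightarrow> (\<forall>x. f (x + axis 3 (2 * pi)) = f x)"

definition slab :: "(real ^ 3) set" where
  "slab = {x. 0 \<le> x $ 3 \<and> x $ 3 \<le> 2 * pi}"

primrec Ck :: "nat \<Rightarrow> ('a::euclidean_space \<Rightarrow> 'b::real_normed_vector) \<Rightarrow> bool" where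
  "Ck 0 f \<longleftrightarrow> continuous_on UNIV f"
| "Ck (Suc k) f \<longleftrightarrow> (\<forall>x. f differentiable (at x)) \<and>
      (\<forall>i\<in>Basis. Ck k (\<lambda>x. frechet_derivative f (at x) i))"

definition Cinf :: "('a::euclidean_space \<Rightarrow> 'b::real_normed_vector) \<Rightarrow> bool" where
  "Cinf f \<longleftrightarrow> (\<forall>k. Ck k f)"

definition divergence :: "(real ^ 'n \<Rightarrow> real ^ 'n) \<Rightarrow> real ^ 'n \<Rightarrow> real" where
  "divergence v x = (\<Sum>i\<in>UNIV. frechet_derivative v (at x) (axis i 1) $ i)"

definition divergence_free :: "(real ^ 'n \<Rightarrow> real ^ 'n) \<Rightarrow> bool" where
  "divergence_free v \<longleftrightarrow> (\<forall>x. divergence v x = 0)"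

text \<open>
  For periodic \<open>f\<close> the closed set \<open>closure {x. f x \<noteq> 0}\<close> is the preimage of the support of \<open>f\<close> in
  \<open>R\<^sup>2 \<times> T\<close>; it is never compact in \<open>R\<^sup>3\<close> unless \<open>f = 0\<close>, so compactness of the support is
  expressed on the fundamental domain.
\<close>

definition Cc_inf :: "(real ^ 3 \<Rightarrow> real ^ 3) set" where
  "Cc_inf = {f. Cinf f \<and> periodic3 f \<and> compact (closure {x. f x \<noteq> 0} \<inter> slab)}"

definition L2_norm_on :: "'a::euclidean_space set \<Rightarrow> ('a \<Rightarrow> 'b::real_normed_vector) \<Rightarrow> ennreal" where
  "L2_norm_on A u =
     (let I = (\<integral>\<^sup>+x\<in>A. ennreal ((norm (u x))\<^sup>2) \<partial>lebesgue)
      in if I = \<infinity> then \<infinity> else ennreal (sqrt (enn2real I)))"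

text \<open>
  Since \<open>1 < \<pi>\<close>, the unit balls of \<open>R\<^sup>2 \<times> T\<close> are isometric images of unit balls of \<open>R\<^sup>3\<close>, so for
  periodic \<open>u\<close> the following supremum is the one over the unit balls of \<open>R\<^sup>2 \<times> T\<close>.
\<close>

definition L2uloc_norm :: "(real ^ 3 \<Rightarrow> real ^ 3) \<Rightarrow> ennreal" where
  "L2uloc_norm u = (SUP x0. L2_norm_on (ball x0 1) u)"

definition L2uloc :: "(real ^ 3 \<Rightarrow> real ^ 3) set" where
  "L2uloc = {u. u \<in> borel_measurable lebesgue \<and> periodic3 u \<and> L2uloc_norm u < \<infinity>}"

definition E2_ring :: "(real ^ 3 \<Rightarrow> real ^ 3) set" where
  "E2_ring = {u \<in> L2uloc. \<forall>\<delta>>0. \<exists>w\<in>Cc_inf.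
     divergence_free w \<and> L2uloc_norm (\<lambda>x. u x - w x) < ennreal \<delta>}"

definition rot3 :: "real \<Rightarrow> real ^ 3 ^ 3" where
  "rot3 \<theta> = vector [vector [cos \<theta>, sin \<theta>, 0],
                    vector [- sin \<theta>, cos \<theta>, 0],
                    vector [0, 0, 1]]"

definition screw :: "real \<Rightarrow> real ^ 3 \<Rightarrow> real ^ 3" where
  "screw \<theta> x = rot3 \<theta> *v x + vector [0, 0, \<theta>]"

definition helical :: "(real ^ 3 \<Rightarrow> real ^ 3) \<Rightarrow> bool" where
  "helical v \<longleftrightarrow> (\<forall>x \<theta>. rot3 \<theta> *v v x = v (screw \<theta> x))"

lemma helical_imp_periodic3:
  assumes "helical v"
  shows "periodic3 v"
proof -
  have r: "rot3 (2 * pi) *v y = y" for y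
    by (simp add: rot3_def vec_eq_iff matrix_vector_mult_def forall_3 sum_3)
  have a: "axis 3 (2 * pi) = (vector [0, 0, 2 * pi] :: real ^ 3)"
    by (simp add: vec_eq_iff forall_3 axis_def)
  show ?thesis
    using assms unfolding periodic3_def helical_def screw_def a by (metis r)
qed

text \<open>
  Helicity of a locally integrable, not necessarily smooth field: it is a limit of smooth helical
  fields in the sense of distributions on \<open>R\<^sup>2 \<times> T\<close>, tested against vector fields. By the lemma
  above the approximating fields are automatically periodic.
\<close>

definition helical_distr :: "(real ^ 3 \<Rightarrow> real ^ 3) \<Rightarrow> bool" where
  "helical_distr u \<longleftrightarrow>
     (\<exists>v :: nat \<Rightarrow> real ^ 3 \<Rightarrow> real ^ 3. (\<forall>n. Cinf (v n) \<and> helical (v n)) \<and>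
        (\<forall>\<phi>\<in>Cc_inf. (\<lambda>n. LINT x:slab|lebesgue. v n x \<bullet> \<phi> x)
           \<longlonglongrightarrow> (LINT x:slab|lebesgue. u x \<bullet> \<phi> x)))"

lemma helical_imp_helical_distr:
  assumes "Cinf u" "helical u"
  shows "helical_distr u"
  unfolding helical_distr_def using assms by (intro exI[of _ "\<lambda>_. u"]) auto

end

theory Submission
  imports Defs
begin

text \<open>
  Put \<open>U\<^sub>t f(x) = R\<^sub>-\<^sub>t f(S\<^sub>t x)\<close>. Choose a divergence-free \<open>w\<close> in \<open>Cc_inf\<close> with
  \<open>L2uloc_norm (u - w) < \<epsilon>\<close> and let \<open>u\<epsilon>\<close> be the mean of \<open>U\<^sub>t w\<close> over \<open>0 \<le> t \<le> 2 \<pi>\<close>. As \<open>U\<close> is a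
  \<open>2 \<pi>\<close>-periodic group action by rigid motions, \<open>u\<epsilon>\<close> is helical, smooth, compactly supported and
  divergence-free. A helical \<open>u\<close> satisfies \<open>U\<^sub>t u = u\<close> almost everywhere for each \<open>t\<close>, so every
  \<open>U\<^sub>t w\<close> is as close to \<open>u\<close> as \<open>w\<close> is, and by convexity so is their mean.

  The identity \<open>U\<^sub>t u = u\<close> needs no mollification: \<open>g = u - U\<^sub>t u\<close> is orthogonal to \<open>Cc_inf\<close> and is
  itself a locally uniform \<open>L\<^sup>2\<close> limit of fields \<open>h\<close> in \<open>Cc_inf\<close>; testing against \<open>\<chi> h\<close> yields
  \<open>\<integral> \<chi> |g|\<^sup>2 \<le> \<integral> \<chi> |g - h|\<^sup>2\<close>. The cut-offs \<open>\<chi>\<close> are the translates of \<open>|w|\<^sup>2\<close>, for any \<open>w \<noteq> 0\<close>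
  in \<open>Cc_inf\<close>.
\<close>

section \<open>Smooth functions\<close>

lemma Ck_continuous: "Ck k f \<Longrightarrow> continuous_on UNIV f"
  by (cases k) (auto intro!: continuous_at_imp_continuous_on differentiable_imp_continuous_within)

text \<open>Derivatives are unique, so any explicitly computed derivative may replace
  \<open>frechet_derivative\<close> in the recursion. The inductions on the order of smoothness use
  this form.\<close>

lemma Ck_Suc_has_derivative:
  assumes "\<And>x. (f has_derivative f' x) (at x)"
  shows "Ck (Suc k) f \<longleftrightarrow> (\<forall>i\<in>Basis. Ck k (\<lambda>x. f' x i))"
proof -
  have "frechet_derivative f (at x) = f' x" for x
    using frechet_derivative_at[OF assms] by simp
  then show ?thesis
    using assms by (auto simp: differentiable_def)
qed

lemma Ck_SucD: "Ck (Suc k) f \<Longrightarrow> Ck k f"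
proof (induction k arbitrary: f)
  case 0
  then show ?case using Ck_continuous[of "Suc 0" f] by simp
next
  case (Suc k)
  have "Ck k (\<lambda>x. frechet_derivative f (at x) i)" if "i \<in> Basis" for i
    using Suc.prems that by (intro Suc.IH) simp
  then show ?case using Suc.prems by simp
qed

section \<open>Closure properties of the classes of k times continuously differentiable maps\<close>

lemma Ck_const: "Ck k (\<lambda>x. c)"
  by (induction k arbitrary: c) (simp_all add: Ck_Suc_has_derivative[OF has_derivative_const])

lemma Ck_bounded_linear:
  assumes "bounded_linear f"
  shows "Ck k f"
proof (cases k)
  case 0
  then show ?thesis
    using assms by (simp add: linear_continuous_on)
next
  case (Suc n)
  show ?thesis
    unfolding Suc Ck_Suc_has_derivative[OF bounded_linear_imp_has_derivative[OF assms]]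
    by (simp add: Ck_const)
qed

lemma Ck_add: "Ck k f \<Longrightarrow> Ck k g \<Longrightarrow> Ck k (\<lambda>x. f x + g x)"
proof (induction k arbitrary: f g)
  case 0
  then show ?case by (auto intro: continuous_intros)
next
  case (Suc k)
  have "((\<lambda>x. f x + g x) has_derivative
      (\<lambda>i. frechet_derivative f (at x) i + frechet_derivative g (at x) i)) (at x)" for x
    using Suc.prems by (intro has_derivative_add) (simp_all add: frechet_derivative_works[symmetric])
  from Ck_Suc_has_derivative[OF this] show ?case
    using Suc by simp
qed

lemma Ck_sum:
  assumes "\<And>i. i \<in> A \<Longrightarrow> Ck k (f i)"
  shows "Ck k (\<lambda>x. \<Sum>i\<in>A. f i x)"
  using assms by (induction A rule: infinite_finite_induct) (auto intro: Ck_add Ck_const)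

lemma Ck_bounded_bilinear:
  assumes bil: "bounded_bilinear h"
  shows "Ck k f \<Longrightarrow> Ck k g \<Longrightarrow> Ck k (\<lambda>x. h (f x) (g x))"
proof (induction k arbitrary: f g)
  case 0
  then show ?case by (auto intro: bounded_bilinear.continuous_on[OF bil])
next
  case (Suc k)
  have "((\<lambda>x. h (f x) (g x)) has_derivative
      (\<lambda>i. h (f x) (frechet_derivative g (at x) i) + h (frechet_derivative f (at x) i) (g x))) (at x)" for x
    using Suc.prems
    by (intro bounded_bilinear.FDERIV[OF bil]) (simp_all add: frechet_derivative_works[symmetric])
  from Ck_Suc_has_derivative[OF this] show ?case
    using Suc.prems Suc.prems[THEN Ck_SucD] by (auto intro!: Ck_add Suc.IH)
qed

lemma Ck_compose:
  fixes f :: "'b::euclidean_space \<Rightarrow> 'c::real_normed_vector"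
    and g :: "'a::euclidean_space \<Rightarrow> 'b"
  shows "Ck k f \<Longrightarrow> Ck k g \<Longrightarrow> Ck k (\<lambda>x. f (g x))"
proof (induction k arbitrary: f)
  case 0
  then show ?case by (auto intro: continuous_on_compose2)
next
  case (Suc k)
  let ?f' = "\<lambda>y. frechet_derivative f (at y)" and ?g' = "\<lambda>x. frechet_derivative g (at x)"
  have f': "(f has_derivative ?f' y) (at y)" for y
    using Suc.prems by (simp add: frechet_derivative_works[symmetric])
  have g': "(g has_derivative ?g' x) (at x)" for x
    using Suc.prems by (simp add: frechet_derivative_works[symmetric])
  have "((\<lambda>x. f (g x)) has_derivative (\<lambda>i. ?f' (g x) (?g' x i))) (at x)" for x
    by (rule has_derivative_compose[OF g' f'])
  \<comment> \<open>\<open>Ck\<close> speaks of derivatives along basis vectors only, so the inner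
    derivative \<open>?g' x i\<close> is expanded in the basis before the induction hypothesis is
    used.\<close>
  moreover have "?f' (g x) (?g' x i) = (\<Sum>b\<in>Basis. (?g' x i \<bullet> b) *\<^sub>R ?f' (g x) b)" for x i
  proof -
    interpret linear "?f' (g x)" by (rule has_derivative_linear[OF f'])
    show ?thesis
      by (subst (1) euclidean_representation[of "?g' x i", symmetric])
        (simp only: sum scale)
  qed
  ultimately have "((\<lambda>x. f (g x)) has_derivative
      (\<lambda>i. \<Sum>b\<in>Basis. (?g' x i \<bullet> b) *\<^sub>R ?f' (g x) b)) (at x)" for x
    by simp
  from Ck_Suc_has_derivative[OF this] show ?case
  proof (simp, intro ballI Ck_sum)
    fix i :: 'a and b :: 'b assume ib: "i \<in> Basis" "b \<in> Basis"
    have "Ck k (\<lambda>x. ?g' x i \<bullet> b)"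
      using Suc.prems ib by (intro Ck_bounded_bilinear[OF bounded_bilinear_inner] Ck_const) auto
    moreover have "Ck k (\<lambda>x. ?f' (g x) b)"
      using Suc.prems(1) ib Ck_SucD[OF Suc.prems(2)] by (intro Suc.IH) auto
    ultimately show "Ck k (\<lambda>x. (?g' x i \<bullet> b) *\<^sub>R ?f' (g x) b)"
      by (rule Ck_bounded_bilinear[OF bounded_bilinear_scaleR])
  qed
qed

text \<open>The two functions are, up to sign, each other's derivatives, so one induction has to
  treat both.\<close>

lemma Ck_sin_cos: "Ck k (sin :: real \<Rightarrow> real) \<and> Ck k (cos :: real \<Rightarrow> real)"
proof (induction k)
  case 0
  then show ?case by (auto intro: continuous_intros)
next
  case (Suc k)
  note s = DERIV_sin[unfolded has_field_derivative_def, where 'a = real]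
  note c = DERIV_cos[unfolded has_field_derivative_def, where 'a = real]
  have "Ck k (\<lambda>x :: real. - sin x)"
    using Suc Ck_compose[OF Ck_bounded_linear[OF bounded_linear_minus[OF bounded_linear_ident]]]
    by blast
  then show ?case
    using Suc unfolding Ck_Suc_has_derivative[OF s] Ck_Suc_has_derivative[OF c] by simp
qed

section \<open>Integrals depending smoothly on a parameter\<close>

text \<open>Differentiation under the integral sign by the Leibniz rule. The derivative in
  \<open>x\<close> is the joint derivative of \<open>F\<close> in the directions
  \<open>(0, i)\<close>, so that regularity of \<open>F\<close> on the product is the only
  input.\<close>

lemma has_derivative_integral_parameter:
  fixes F :: "real \<times> 'a::euclidean_space \<Rightarrow> 'b::euclidean_space"
  assumes "Ck 1 F"
  shows "((\<lambda>x. integral {a..b} (\<lambda>t. F (t, x))) has_derivative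
      (\<lambda>i. integral {a..b} (\<lambda>t. frechet_derivative F (at (t, x)) (0, i)))) (at x)"
proof -
  let ?D = "\<lambda>x t. frechet_derivative F (at (t, x))"
  \<comment> \<open>The Leibniz rule takes the partial derivative as a point of the normed space of
    bounded operators.\<close>
  let ?fx = "\<lambda>x t. Blinfun (\<lambda>i. ?D x t (0, i))"
  have F': "(F has_derivative ?D x t) (at (t, x))" for x t
    using assms by (simp add: frechet_derivative_works[symmetric])
  have D: "((\<lambda>x. F (t, x)) has_derivative (\<lambda>i. ?D x t (0, i))) (at x)" for x t
  proof -
    have "((\<lambda>x. (t, x)) has_derivative (\<lambda>i. (0, i))) (at x)"
      by (auto intro!: derivative_eq_intros)
    from has_derivative_compose[OF this F'] show ?thesis .
  qed
  have ap: "blinfun_apply (?fx x t) = (\<lambda>i. ?D x t (0, i))" for x t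
    using bounded_linear_Blinfun_apply[OF has_derivative_bounded_linear[OF D]] by simp
  have cF: "continuous_on UNIV F" using Ck_continuous[OF assms] .
  have int: "(\<lambda>t. F (t, x)) integrable_on cbox a b" for x
    by (intro integrable_continuous continuous_on_compose2[OF cF] continuous_intros) auto
  \<comment> \<open>\<open>(0, i)\<close> is a basis vector of the product space, so
    \<open>Ck 1 F\<close> gives this continuity directly.\<close>
  have cD: "continuous_on UNIV (\<lambda>p. frechet_derivative F (at p) (0, i))" if "i \<in> Basis" for i
    using assms that by (auto simp: Basis_prod_def)
  have cont: "continuous_on (UNIV \<times> cbox a b) (\<lambda>(x, t). ?fx x t)"
  proof (rule continuous_on_blinfun_componentwise)
    fix i :: 'a assume "i \<in> Basis"
    have "continuous_on (UNIV \<times> cbox a b) (\<lambda>p :: 'a \<times> real. frechet_derivative F (at (snd p, fst p)) (0, i))"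
      by (intro continuous_on_compose2[OF cD[OF \<open>i \<in> Basis\<close>]] continuous_intros) auto
    then show "continuous_on (UNIV \<times> cbox a b) (\<lambda>p. blinfun_apply (case p of (x, t) \<Rightarrow> ?fx x t) i)"
      by (simp add: split_beta ap)
  qed
  have "((\<lambda>x. integral (cbox a b) (\<lambda>t. F (t, x))) has_derivative integral (cbox a b) (?fx x)) (at x)"
    by (rule leibniz_rule[where U = UNIV and f = "\<lambda>x t. F (t, x)" and fx = ?fx])
      (use D int cont in \<open>auto simp: ap\<close>)
  moreover have "?fx x integrable_on cbox a b"
  proof (rule integrable_continuous)
    have "continuous_on (cbox a b) (\<lambda>t. (\<lambda>(x, t). ?fx x t) (x, t))"
      by (rule continuous_on_compose2[OF cont]) (auto intro: continuous_on_Pair)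
    then show "continuous_on (cbox a b) (?fx x)" by simp
  qed
  then have "blinfun_apply (integral (cbox a b) (?fx x))
      = (\<lambda>i. integral (cbox a b) (\<lambda>t. ?D x t (0, i)))"
    by (simp add: fun_eq_iff blinfun_apply_integral ap)
  ultimately show ?thesis by simp
qed

text \<open>The induction generalises over \<open>F\<close>: every partial derivative of the
  integral is again a parameter integral, with a partial derivative of \<open>F\<close>, still
  smooth, as integrand.\<close>

lemma Ck_integral_parameter:
  fixes F :: "real \<times> 'a::euclidean_space \<Rightarrow> 'b::euclidean_space"
  assumes "Cinf F"
  shows "Ck k (\<lambda>x. integral {a..b} (\<lambda>t. F (t, x)))"
  using assms
proof (induction k arbitrary: F)
  case (0 F)
  from 0 have "Ck 1 F" by (simp only: Cinf_def)
  from has_derivative_integral_parameter[OF this] show ?case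
    by (auto intro!: continuous_at_imp_continuous_on has_derivative_continuous)
next
  case (Suc k F)
  then have "Ck 1 F" by (simp only: Cinf_def)
  have "Cinf (\<lambda>p. frechet_derivative F (at p) (0, i))" if "i \<in> Basis" for i
    unfolding Cinf_def
  proof
    fix n
    have "Ck (Suc n) F" using Suc.prems by (simp only: Cinf_def)
    then show "Ck n (\<lambda>p. frechet_derivative F (at p) (0, i))"
      using that by (auto simp: Basis_prod_def)
  qed
  then show ?case
    unfolding Ck_Suc_has_derivative[OF has_derivative_integral_parameter[OF \<open>Ck 1 F\<close>]]
    using Suc.IH by blast
qed

lemma Cinf_compose:
  fixes f :: "'b::euclidean_space \<Rightarrow> 'c::real_normed_vector" and g :: "'a::euclidean_space \<Rightarrow> 'b"
  shows "Cinf f \<Longrightarrow> Cinf g \<Longrightarrow> Cinf (\<lambda>x. f (g x))"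
  by (simp add: Cinf_def Ck_compose)

lemma Cinf_add: "Cinf f \<Longrightarrow> Cinf g \<Longrightarrow> Cinf (\<lambda>x. f x + g x)"
  by (simp add: Cinf_def Ck_add)

lemma Cinf_const: "Cinf (\<lambda>x. c)"
  by (simp add: Cinf_def Ck_const)

lemma Cinf_bounded_linear: "bounded_linear f \<Longrightarrow> Cinf f"
  by (simp add: Cinf_def Ck_bounded_linear)

lemma Cinf_bounded_bilinear: "bounded_bilinear h \<Longrightarrow> Cinf f \<Longrightarrow> Cinf g \<Longrightarrow> Cinf (\<lambda>x. h (f x) (g x))"
  by (simp add: Cinf_def Ck_bounded_bilinear)

lemma Cinf_integral_parameter:
  fixes F :: "real \<times> 'a::euclidean_space \<Rightarrow> 'b::euclidean_space"
  shows "Cinf F \<Longrightarrow> Cinf (\<lambda>x. integral {a..b} (\<lambda>t. F (t, x)))"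
  using Ck_integral_parameter by (auto simp: Cinf_def)

lemma Cinf_continuous: "Cinf f \<Longrightarrow> continuous_on A f"
  using Ck_continuous by (auto simp: Cinf_def intro: continuous_on_subset)

lemma Cinf_has_derivative: "Cinf f \<Longrightarrow> (f has_derivative frechet_derivative f (at x)) (at x)"
  unfolding Cinf_def frechet_derivative_works[symmetric] using Ck.simps(2) by blast

section \<open>Screw motions and Lebesgue measure\<close>

lemma rot3_vec:
  "(rot3 t *v y) $ 1 = cos t * y $ 1 + sin t * y $ 2"
  "(rot3 t *v y) $ 2 = cos t * y $ 2 - sin t * y $ 1"
  "(rot3 t *v y) $ 3 = y $ 3"
  by (simp_all add: rot3_def matrix_vector_mult_def sum_3)

lemma screw_nth:
  "screw t y $ 1 = cos t * y $ 1 + sin t * y $ 2"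
  "screw t y $ 2 = cos t * y $ 2 - sin t * y $ 1"
  "screw t y $ 3 = y $ 3 + t"
  by (simp_all add: screw_def rot3_vec)

lemma rot3_add: "rot3 s *v (rot3 t *v y) = rot3 (s + t) *v y"
  by (simp add: vec_eq_iff forall_3 rot3_vec cos_add sin_add algebra_simps)

lemma screw_add: "screw s (screw t y) = screw (s + t) y"
  by (simp add: vec_eq_iff forall_3 screw_nth cos_add sin_add algebra_simps)

lemma rot3_0 [simp]: "rot3 0 *v y = y"
  by (simp add: vec_eq_iff forall_3 rot3_vec)

lemma screw_0 [simp]: "screw 0 y = y"
  by (simp add: vec_eq_iff forall_3 screw_nth)

lemma orthogonal_rot3: "orthogonal_transformation ((*v) (rot3 t))"
proof -
  have "(rot3 t *v x) \<bullet> (rot3 t *v y) = ((sin t)\<^sup>2 + (cos t)\<^sup>2) * (x $ 1 * y $ 1 + x $ 2 * y $ 2) + x $ 3 * y $ 3"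
    for x y
    unfolding inner_vec_def sum_3 rot3_vec inner_real_def by algebra
  then show ?thesis
    by (simp add: orthogonal_transformation_def inner_vec_def sum_3)
qed

lemma norm_rot3 [simp]: "norm (rot3 t *v y) = norm y"
  using orthogonal_rot3 by (rule orthogonal_transformation_norm)

lemma inner_rot3 [simp]: "(rot3 t *v x) \<bullet> (rot3 t *v y) = x \<bullet> y"
  using orthogonal_rot3 by (simp add: orthogonal_transformation_def)

lemma dist_screw [simp]: "dist (screw t x) (screw t y) = dist x y"
  by (simp add: dist_norm screw_def matrix_vector_mult_diff_distrib[symmetric])

lemma screw_vimage: "screw t -` A = screw (- t) ` A"
proof -
  have "x \<in> screw (- t) ` A" if "screw t x \<in> A" for x
    using that by (intro image_eqI[of _ _ "screw t x"]) (simp_all add: screw_add)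
  then show ?thesis by (auto simp: screw_add)
qed

lemma screw_image:
  "screw t ` A = (\<lambda>x. vector [0, 0, t] + x) ` ((*v) (rot3 t) ` A)"
  by (simp add: image_image screw_def add.commute)

section \<open>Invariance of Lebesgue measure\<close>

lemma screw_lmeasurable:
  assumes "A \<in> lmeasurable"
  shows "screw t ` A \<in> lmeasurable \<and> measure lebesgue (screw t ` A) = measure lebesgue A"
  using measurable_orthogonal_image[OF orthogonal_rot3 assms]
    measure_orthogonal_image[OF orthogonal_rot3 assms]
  unfolding screw_image by (simp add: measurable_translation measure_translation)

lemma screw_measurable: "screw t \<in> lebesgue \<rightarrow>\<^sub>M lebesgue"
proof (rule measurableI)
  fix A :: "(real ^ 3) set" assume "A \<in> sets lebesgue"
  then have "(*v) (rot3 (- t)) ` A \<in> sets lebesgue"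
    by (rule differentiable_image_in_sets_lebesgue)
      (auto intro: linear_imp_differentiable_on matrix_vector_mul_linear)
  then show "screw t -` A \<inter> space lebesgue \<in> sets lebesgue"
    by (simp add: screw_vimage screw_image lebesgue_sets_translation)
qed simp

lemma distr_screw: "distr lebesgue lebesgue (screw t) = lebesgue"
proof (rule measure_eqI)
  fix A assume "A \<in> sets (distr lebesgue lebesgue (screw t))"
  then have A: "A \<in> sets lebesgue" by simp
  have sA: "screw (- t) ` A \<in> sets lebesgue"
    using measurable_sets[OF screw_measurable A, of t] by (simp add: screw_vimage)
  have "emeasure lebesgue (screw (- t) ` A) = emeasure lebesgue A"
  proof (cases "A \<in> lmeasurable")
    case True
    then show ?thesis
      using screw_lmeasurable[OF True, of "- t"] by (simp add: emeasure_eq_measure2)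
  next
    \<comment> \<open>Were the image of finite measure, moving it back by the inverse motion would
      make \<open>A\<close> of finite measure; so both measures are infinite.\<close>
    case False
    have "screw t ` screw (- t) ` A = A"
      by (simp add: image_image screw_add)
    then have "screw (- t) ` A \<notin> lmeasurable"
      using False screw_lmeasurable by metis
    then show ?thesis
      using False A sA by (auto simp: fmeasurable_def top.not_eq_extremum[symmetric] simp del: emeasure_completion)
  qed
  then show "emeasure (distr lebesgue lebesgue (screw t)) A = emeasure lebesgue A"
    using A by (simp add: emeasure_distr[OF screw_measurable] screw_vimage)
qed simp

lemma translation_measurable: "(\<lambda>x. c + x) \<in> lebesgue \<rightarrow>\<^sub>M lebesgue"
  for c :: "'a::euclidean_space"
  using lebesgue_affine_measurable[of "\<lambda>_. 1" c] by (simp add: euclidean_representation)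

lemma distr_translation: "distr lebesgue lebesgue (\<lambda>x. c + x) = lebesgue"
  for c :: "'a::euclidean_space"
  using lebesgue_affine_euclidean[of "\<lambda>_. 1" c]
  by (simp add: euclidean_representation density_1)

section \<open>Periodic functions and integrals over the fundamental domain\<close>

lemma negligible_plane3: "negligible {x :: real ^ 3. x $ 3 = c}"
  using negligible_standard_hyperplane[of "axis 3 1 :: real ^ 3" c]
  by (simp add: inner_axis axis_in_Basis_iff)
 
lemma periodic3_int:
  assumes "periodic3 f"
  shows "f (x + axis 3 (2 * pi * real_of_int k)) = f x"
proof -
  have nat: "f (x + axis 3 (2 * pi * real n)) = f x" for n x
  proof (induction n)
    case (Suc n)
    have "x + axis 3 (2 * pi * real (Suc n)) = x + axis 3 (2 * pi * real n) + axis 3 (2 * pi)"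
      by (simp add: vec_eq_iff axis_def algebra_simps)
    then show ?case using assms Suc by (metis periodic3_def)
  qed (simp add: axis_def vec_eq_iff[symmetric] zero_vec_def[symmetric])
  show ?thesis
  proof (cases "0 \<le> k")
    case True
    then show ?thesis using nat[of x "nat k"] by simp
  next
    \<comment> \<open>For negative \<open>k\<close> the nonnegative case is applied at the shifted
      point, from which it leads back to \<open>x\<close>.\<close>
    case False
    have "x = (x + axis 3 (2 * pi * real_of_int k)) + axis 3 (2 * pi * real (nat (- k)))"
      using False by (simp add: vec_eq_iff axis_def)
    then show ?thesis using nat by metis
  qed
qed


lemma set_integral_measure_preserving:
  fixes f :: "'a::euclidean_space \<Rightarrow> real"
  assumes T: "T \<in> lebesgue \<rightarrow>\<^sub>M lebesgue" "distr lebesgue lebesgue T = lebesgue"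
    and f: "set_integrable lebesgue B f"
  shows "set_integrable lebesgue (T -` B) (\<lambda>x. f (T x))"
    and "(LINT x:T -` B|lebesgue. f (T x)) = (LINT x:B|lebesgue. f x)"
proof -
  let ?g = "\<lambda>x. indicat_real B x *\<^sub>R f x"
  have g: "integrable lebesgue ?g" using f by (simp add: set_integrable_def)
  then have g': "integrable (distr lebesgue lebesgue T) ?g" by (simp add: T)
  have eq: "indicat_real (T -` B) x *\<^sub>R f (T x) = ?g (T x)" for x
    by (simp add: indicator_def)
  show "set_integrable lebesgue (T -` B) (\<lambda>x. f (T x))"
    unfolding set_integrable_def eq using integrable_distr[OF T(1) g'] .
  show "(LINT x:T -` B|lebesgue. f (T x)) = (LINT x:B|lebesgue. f x)"
    unfolding set_lebesgue_integral_def eq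
    using integral_distr[OF T(1) borel_measurable_integrable[OF g]] by (simp add: T)
qed

text \<open>The motion carries the slab onto the layer between heights \<open>t\<close> and
  \<open>2 * pi + t\<close>. Cutting the slab at height \<open>t\<close> and lifting its lower part
  by one period yields the same layer. The bounds on \<open>t\<close> place the cut inside the
  slab.\<close>

lemma slab_integral_screw:
  fixes f :: "real ^ 3 \<Rightarrow> real"
  assumes per: "periodic3 f" and f: "set_integrable lebesgue slab f" and t: "0 \<le> t" "t \<le> 2 * pi"
  shows "set_integrable lebesgue slab (\<lambda>x. f (screw t x))"
    and "(LINT x:slab|lebesgue. f (screw t x)) = (LINT x:slab|lebesgue. f x)"
proof -
  define S where "S a b = {x :: real ^ 3. a \<le> x $ 3 \<and> x $ 3 \<le> b}" for a b
  have S: "S a b \<in> sets lebesgue" for a b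
    unfolding S_def by simp
  have slab: "slab = S 0 t \<union> S t (2 * pi)"
    using t by (auto simp: S_def slab_def)
  \<comment> \<open>Adjacent closed layers share a plane, which is a null set, so integrals still
    add up.\<close>
  have plane: "AE x in lebesgue. x \<notin> S a b \<or> x \<notin> S b c" for a b c
  proof (rule AE_I')
    show "{x. x $ 3 = b} \<in> null_sets (lebesgue :: (real ^ 3) measure)"
      using negligible_plane3 by (simp add: negligible_iff_null_sets)
  qed (auto simp: S_def)
  have f1: "set_integrable lebesgue (S 0 t) f" and f2: "set_integrable lebesgue (S t (2 * pi)) f"
    using f S by (auto intro!: set_integrable_subset[OF f] simp: slab)
  define T where "T = (\<lambda>x. axis 3 (- 2 * pi) + x :: real ^ 3)"
  have T: "T \<in> lebesgue \<rightarrow>\<^sub>M lebesgue" "distr lebesgue lebesgue T = lebesgue"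
    unfolding T_def by (rule translation_measurable distr_translation)+
  have "T -` S 0 t = S (2 * pi) (2 * pi + t)"
    by (auto simp: T_def S_def axis_def)
  moreover have "f (T x) = f x" for x
    using periodic3_int[OF per, of x "- 1"] by (simp add: T_def add.commute)
  ultimately have f3: "set_integrable lebesgue (S (2 * pi) (2 * pi + t)) f"
    and eq: "(LINT x:S (2 * pi) (2 * pi + t)|lebesgue. f x) = (LINT x:S 0 t|lebesgue. f x)"
    using set_integral_measure_preserving[OF T f1] by simp_all
  have U: "S t (2 * pi) \<union> S (2 * pi) (2 * pi + t) = S t (2 * pi + t)"
    using t by (auto simp: S_def)
  have f4: "set_integrable lebesgue (S t (2 * pi + t)) f"
    using set_integrable_Un[OF f2 f3 S S] U by simp
  have "(LINT x:S t (2 * pi + t)|lebesgue. f x)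
      = (LINT x:S t (2 * pi)|lebesgue. f x) + (LINT x:S (2 * pi) (2 * pi + t)|lebesgue. f x)"
    unfolding U[symmetric] using plane S f2 f3 by (intro set_integral_Un_AE) auto
  also have "\<dots> = (LINT x:slab|lebesgue. f x)"
    unfolding eq slab using plane S f1 f2 by (subst set_integral_Un_AE) auto
  finally have fin: "(LINT x:S t (2 * pi + t)|lebesgue. f x) = (LINT x:slab|lebesgue. f x)" .
  have "screw t -` S t (2 * pi + t) = slab"
    by (auto simp: S_def slab_def screw_nth)
  then show "set_integrable lebesgue slab (\<lambda>x. f (screw t x))"
    and "(LINT x:slab|lebesgue. f (screw t x)) = (LINT x:slab|lebesgue. f x)"
    using set_integral_measure_preserving[OF screw_measurable[of t] distr_screw f4] fin by simp_all
qed

lemma nn_integral_ball_screw: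
  assumes "f \<in> borel_measurable lebesgue"
  shows "(\<integral>\<^sup>+x\<in>ball x0 r. f (screw t x) \<partial>lebesgue) = (\<integral>\<^sup>+x\<in>ball (screw t x0) r. f x \<partial>lebesgue)"
proof -
  have [measurable]: "f \<in> borel_measurable lebesgue" by fact
  have b[measurable]: "ball (screw t x0) r \<in> sets lebesgue" by simp
  have eq: "indicator (ball x0 r) x = indicator (ball (screw t x0) r) (screw t x)" for x :: "real ^ 3"
    by (simp add: indicator_def)
  have "(\<integral>\<^sup>+x\<in>ball (screw t x0) r. f x \<partial>distr lebesgue lebesgue (screw t))
     = (\<integral>\<^sup>+x. f (screw t x) * indicator (ball (screw t x0) r) (screw t x) \<partial>lebesgue)"
    by (rule nn_integral_distr[OF screw_measurable]) measurable
  then show ?thesis by (simp add: distr_screw eq)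
qed

text \<open>Prepares Tonelli's theorem on the product of \<open>lborel\<close> and
  \<open>lebesgue\<close>. A countable cover by Borel sets of finite measure also serves the
  completed measure.\<close>

lemma sigma_finite_lebesgue: "sigma_finite_measure (lebesgue :: 'a::euclidean_space measure)"
proof
  obtain A :: "'a set set" where "countable A" "A \<subseteq> sets lborel" "\<Union>A = UNIV"
      "\<forall>a\<in>A. emeasure lborel a \<noteq> \<infinity>"
    using sigma_finite_measure.sigma_finite_countable[OF sigma_finite_lborel] by auto
  then show "\<exists>A::'a set set. countable A \<and> A \<subseteq> sets lebesgue \<and> \<Union>A = space lebesgue \<and>
      (\<forall>a\<in>A. emeasure lebesgue a \<noteq> \<infinity>)"
    by (intro exI[of _ A]) (auto simp: subset_iff)
qed

section \<open>The action of screw motions on vector fields\<close>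

text \<open>The rotation is \<open>cos t *\<^sub>R P + sin t *\<^sub>R J + Q\<close> with fixed
  linear maps \<open>P\<close>, \<open>J\<close>, \<open>Q\<close>, so smoothness with a variable
  angle reduces to sums, products and composition.\<close>

lemma Cinf_rot3:
  fixes v :: "'a::euclidean_space \<Rightarrow> real ^ 3"
  assumes a: "Cinf a" and v: "Cinf v"
  shows "Cinf (\<lambda>p. rot3 (a p) *v v p)"
proof -
  define P J Q :: "real ^ 3 \<Rightarrow> real ^ 3" where
    "P = (\<lambda>y. vector [y $ 1, y $ 2, 0])" and "J = (\<lambda>y. vector [y $ 2, - y $ 1, 0])"
    and "Q = (\<lambda>y. vector [0, 0, y $ 3])"
  note scale = Cinf_bounded_bilinear[OF bounded_bilinear_scaleR]
  have sin: "Cinf (\<lambda>p. sin (a p))" and cos: "Cinf (\<lambda>p. cos (a p))"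
    using Cinf_compose[OF _ a] Ck_sin_cos by (auto simp: Cinf_def)
  have "bounded_linear P" "bounded_linear J" "bounded_linear Q"
    unfolding linear_conv_bounded_linear[symmetric] P_def J_def Q_def
    by (auto intro!: linearI simp: vec_eq_iff forall_3)
  then have lin: "Cinf P" "Cinf J" "Cinf Q"
    by (auto intro: Cinf_bounded_linear)
  have "rot3 t *v y = cos t *\<^sub>R P y + sin t *\<^sub>R J y + Q y" for t y
    by (simp add: vec_eq_iff forall_3 rot3_vec P_def J_def Q_def)
  then show ?thesis
    using Cinf_add[OF Cinf_add] scale[OF cos Cinf_compose[OF lin(1) v]]
      scale[OF sin Cinf_compose[OF lin(2) v]] Cinf_compose[OF lin(3) v]
    by simp
qed

text \<open>This is the operator \<open>U\<^sub>t\<close>. The inverse rotation in front makes the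
  helical fields exactly the common fixed points of all these operators.\<close>

definition screw_field :: "real \<Rightarrow> (real ^ 3 \<Rightarrow> real ^ 3) \<Rightarrow> real ^ 3 \<Rightarrow> real ^ 3" where
  "screw_field t w x = rot3 (- t) *v w (screw t x)"

text \<open>Smoothness jointly in angle and position is what differentiation under the average over
  the angle requires.\<close>

lemma Cinf_screw_field_joint:
  assumes "Cinf w"
  shows "Cinf (\<lambda>p. screw_field (fst p) w (snd p))"
proof -
  have fst: "Cinf (fst :: real \<times> (real ^ 3) \<Rightarrow> real)" and snd: "Cinf (snd :: real \<times> (real ^ 3) \<Rightarrow> real ^ 3)"
    by (auto intro: Cinf_bounded_linear bounded_linear_fst bounded_linear_snd)
  have ax: "(\<lambda>t. vector [0, 0, t] :: real ^ 3) = axis 3"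
    by (simp add: fun_eq_iff vec_eq_iff forall_3 axis_def)
  have "bounded_linear (axis 3 :: real \<Rightarrow> real ^ 3)"
    unfolding linear_conv_bounded_linear[symmetric]
    by (auto intro!: linearI simp: vec_eq_iff forall_3 axis_def)
  then have "Cinf (\<lambda>t. vector [0, 0, t] :: real ^ 3)"
    unfolding ax by (rule Cinf_bounded_linear)
  from Cinf_add[OF Cinf_rot3[OF fst snd] Cinf_compose[OF this fst]]
  have screw: "Cinf (\<lambda>p. screw (fst p) (snd p))"
    by (simp add: screw_def)
  have "Cinf (\<lambda>p :: real \<times> (real ^ 3). - fst p)"
    by (intro Cinf_bounded_linear bounded_linear_minus bounded_linear_fst)
  from Cinf_rot3[OF this Cinf_compose[OF assms screw]] show ?thesis
    by (simp add: screw_field_def)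
qed

lemma Cinf_screw_field:
  assumes "Cinf w"
  shows "Cinf (screw_field t w)"
proof -
  have "Cinf (\<lambda>x :: real ^ 3. (t, 0) + (0, x))"
    by (intro Cinf_add Cinf_const Cinf_bounded_linear bounded_linear_Pair
        bounded_linear_ident bounded_linear_zero)
  from Cinf_compose[OF Cinf_screw_field_joint[OF assms] this] show ?thesis by simp
qed

lemma screw_field_add: "screw_field s (screw_field t w) = screw_field (s + t) w"
  by (simp add: fun_eq_iff screw_field_def rot3_add screw_add add.commute)

lemma screw_field_0 [simp]: "screw_field 0 w = w"
  by (simp add: fun_eq_iff screw_field_def)

lemma helical_iff_screw_field: "helical v \<longleftrightarrow> (\<forall>t. screw_field t v = v)"
proof -
  have "rot3 t *v v x = v (screw t x) \<longleftrightarrow> screw_field t v x = v x" for t x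
    unfolding screw_field_def
    by (metis rot3_add rot3_0 add.left_inverse add.right_inverse)
  then show ?thesis by (auto simp: helical_def fun_eq_iff)
qed

lemma screw_add_axis3: "screw t (x + axis 3 c) = screw t x + axis 3 c"
  by (simp add: vec_eq_iff forall_3 screw_nth axis_def)

lemma periodic3_screw_field: "periodic3 w \<Longrightarrow> periodic3 (screw_field t w)"
  by (simp add: periodic3_def screw_field_def screw_add_axis3)

text \<open>A full turn is the identity rotation together with a vertical shift by one period, so on
  periodic fields the action factors through the circle.\<close>

lemma screw_field_2pi:
  assumes "periodic3 w"
  shows "screw_field (t + 2 * pi) w = screw_field t w"
proof -
  have "screw (t + 2 * pi) x = screw t x + axis 3 (2 * pi)" for x
    by (simp add: vec_eq_iff forall_3 screw_nth axis_def)
  moreover have "rot3 (- (t + 2 * pi)) *v y = rot3 (- t) *v y" for y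
    using sin_periodic[of t] cos_periodic[of t]
    by (simp add: vec_eq_iff forall_3 rot3_vec sin_minus cos_minus del: sin_periodic cos_periodic minus_add_distrib)
  ultimately show ?thesis
    using assms by (simp add: screw_field_def periodic3_def fun_eq_iff)
qed

lemma ex_translate_slab:
  fixes x :: "real ^ 3"
  shows "\<exists>k. x + axis 3 (2 * pi * real_of_int k) \<in> slab"
proof -
  let ?k = "\<lfloor>x $ 3 / (2 * pi)\<rfloor>"
  have "real_of_int ?k * (2 * pi) \<le> x $ 3" "x $ 3 \<le> (real_of_int ?k + 1) * (2 * pi)"
    using floor_divide_lower[of "2 * pi" "x $ 3"] floor_divide_upper[of "2 * pi" "x $ 3"] by simp_all
  then show ?thesis
    by (intro exI[of _ "- ?k"]) (auto simp: slab_def axis_def algebra_simps)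
qed

text \<open>The slab bounds the third coordinate and periodicity moves any point into it, so compact
  support amounts to support in a vertical cylinder. In this form it is visibly preserved by screw
  motions.\<close>

lemma Cc_inf_iff:
  "f \<in> Cc_inf \<longleftrightarrow> Cinf f \<and> periodic3 f \<and> (\<exists>R. \<forall>x. f x \<noteq> 0 \<longrightarrow> (x $ 1)\<^sup>2 + (x $ 2)\<^sup>2 \<le> R)"
proof -
  let ?C = "closure {x. f x \<noteq> 0}"
  have norm3: "(norm x)\<^sup>2 = (x $ 1)\<^sup>2 + (x $ 2)\<^sup>2 + (x $ 3)\<^sup>2" for x :: "real ^ 3"
    by (simp add: norm_vec_def L2_set_def sum_3)
  have "\<exists>R. \<forall>x. f x \<noteq> 0 \<longrightarrow> (x $ 1)\<^sup>2 + (x $ 2)\<^sup>2 \<le> R" if per: "periodic3 f" and cpt: "compact (?C \<inter> slab)"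
  proof -
    obtain B where B: "\<And>x. x \<in> ?C \<inter> slab \<Longrightarrow> norm x \<le> B"
      using compact_imp_bounded[OF cpt] by (auto simp: bounded_iff)
    have "(x $ 1)\<^sup>2 + (x $ 2)\<^sup>2 \<le> B\<^sup>2" if "f x \<noteq> 0" for x
    proof -
      obtain k where k: "x + axis 3 (2 * pi * real_of_int k) \<in> slab" (is "?y \<in> _")
        using ex_translate_slab by blast
      have "f ?y \<noteq> 0" using that periodic3_int[OF per] by simp
      then have "norm ?y \<le> B" using k closure_subset[of "{x. f x \<noteq> 0}"] by (intro B) auto
      then have "(norm ?y)\<^sup>2 \<le> B\<^sup>2" by (simp add: power_mono)
      then have "(?y $ 1)\<^sup>2 + (?y $ 2)\<^sup>2 \<le> B\<^sup>2"
        unfolding norm3 using zero_le_power2[of "?y $ 3"] by linarith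
      then show ?thesis by (simp add: axis_def)
    qed
    then show ?thesis by blast
  qed
  moreover have "compact (?C \<inter> slab)" if R: "\<forall>x. f x \<noteq> 0 \<longrightarrow> (x $ 1)\<^sup>2 + (x $ 2)\<^sup>2 \<le> R" for R
  proof -
    have "closed {x :: real ^ 3. (x $ 1)\<^sup>2 + (x $ 2)\<^sup>2 \<le> R}"
      by (intro closed_Collect_le continuous_intros)
    then have C: "?C \<subseteq> {x. (x $ 1)\<^sup>2 + (x $ 2)\<^sup>2 \<le> R}"
      using R by (intro closure_minimal) auto
    have "norm x \<le> sqrt (R + (2 * pi)\<^sup>2)" if "x \<in> ?C \<inter> slab" for x
    proof (rule real_le_rsqrt)
      have "(x $ 3)\<^sup>2 \<le> (2 * pi)\<^sup>2"
        using that by (intro power_mono) (auto simp: slab_def)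
      then show "(norm x)\<^sup>2 \<le> R + (2 * pi)\<^sup>2"
        unfolding norm3 using C that by fastforce
    qed
    then have "bounded (?C \<inter> slab)" by (auto simp: bounded_iff)
    moreover have "closed slab"
      unfolding slab_def by (intro closed_Collect_conj closed_Collect_le continuous_intros)
    ultimately show ?thesis by (simp add: compact_eq_bounded_closed closed_Int)
  qed
  ultimately show ?thesis by (auto simp: Cc_inf_def)
qed

lemma screw_horizontal: "(screw t x $ 1)\<^sup>2 + (screw t x $ 2)\<^sup>2 = (x $ 1)\<^sup>2 + (x $ 2)\<^sup>2"
proof -
  have "(screw t x $ 1)\<^sup>2 + (screw t x $ 2)\<^sup>2 = ((sin t)\<^sup>2 + (cos t)\<^sup>2) * ((x $ 1)\<^sup>2 + (x $ 2)\<^sup>2)"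
    unfolding screw_nth by algebra
  then show ?thesis by simp
qed

lemma screw_field_nonzero: "screw_field t w x \<noteq> 0 \<longleftrightarrow> w (screw t x) \<noteq> 0"
  by (metis norm_eq_zero norm_rot3 screw_field_def)

lemma screw_field_Cc_inf: "w \<in> Cc_inf \<Longrightarrow> screw_field t w \<in> Cc_inf"
  unfolding Cc_inf_iff screw_field_nonzero
  by (metis Cinf_screw_field periodic3_screw_field screw_horizontal)

text \<open>The derivative of the transformed field is the original derivative conjugated by a
  rotation, and the divergence is its trace.\<close>

lemma divergence_screw_field:
  assumes "Cinf w"
  shows "divergence (screw_field t w) x = divergence w (screw t x)"
proof -
  let ?A = "frechet_derivative w (at (screw t x))"
  have "(screw t has_derivative (*v) (rot3 t)) (at x)"
    unfolding screw_def
    by (intro has_derivative_add_const bounded_linear_imp_has_derivative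
        matrix_vector_mul_bounded_linear)
  from has_derivative_compose[OF this Cinf_has_derivative[OF assms]]
  have "((\<lambda>x. w (screw t x)) has_derivative (\<lambda>h. ?A (rot3 t *v h))) (at x)" .
  from bounded_linear.has_derivative[OF matrix_vector_mul_bounded_linear this]
  have "(screw_field t w has_derivative (\<lambda>h. rot3 (- t) *v ?A (rot3 t *v h))) (at x)"
    by (simp add: screw_field_def[abs_def])
  from frechet_derivative_at[OF this]
  have D: "frechet_derivative (screw_field t w) (at x) h = rot3 (- t) *v ?A (rot3 t *v h)" for h
    by metis
  interpret linear ?A
    by (rule has_derivative_linear[OF Cinf_has_derivative[OF assms]])
  have e: "rot3 t *v axis 1 1 = cos t *\<^sub>R axis 1 1 + (- sin t) *\<^sub>R axis 2 1"
    "rot3 t *v axis 2 1 = sin t *\<^sub>R axis 1 1 + cos t *\<^sub>R axis 2 1"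
    "rot3 t *v axis 3 1 = axis 3 1"
    by (simp_all add: vec_eq_iff forall_3 rot3_vec axis_def)
  have "divergence (screw_field t w) x
    = ((sin t)\<^sup>2 + (cos t)\<^sup>2) * (?A (axis 1 1) $ 1 + ?A (axis 2 1) $ 2) + ?A (axis 3 1) $ 3"
    unfolding divergence_def D sum_3 e add scale rot3_vec vector_add_component vector_scaleR_component
      sin_minus cos_minus real_scaleR_def
    by algebra
  then show ?thesis by (simp add: divergence_def sum_3)
qed

section \<open>Local square integrals\<close>

text \<open>Squared integrals in \<open>ennreal\<close> avoid the square root and the case
  distinction on infinity in \<open>L2_norm_on\<close>.\<close>

abbreviation sqint :: "'a::euclidean_space set \<Rightarrow> ('a \<Rightarrow> 'b::real_normed_vector) \<Rightarrow> ennreal" where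
  "sqint A f \<equiv> (\<integral>\<^sup>+x\<in>A. ennreal ((norm (f x))\<^sup>2) \<partial>lebesgue)"

lemma L2_norm_on_le_iff:
  assumes "0 \<le> d"
  shows "L2_norm_on A f \<le> ennreal d \<longleftrightarrow> sqint A f \<le> ennreal (d\<^sup>2)"
proof (cases "sqint A f")
  case (real r)
  then show ?thesis
    using assms real_sqrt_le_iff[of r "d\<^sup>2"]
    by (simp add: L2_norm_on_def ennreal_le_iff del: real_sqrt_le_iff)
next
  case top
  then show ?thesis by (simp add: L2_norm_on_def top_unique)
qed

lemma L2uloc_norm_le_iff:
  assumes "0 \<le> d"
  shows "L2uloc_norm f \<le> ennreal d \<longleftrightarrow> (\<forall>x0. sqint (ball x0 1) f \<le> ennreal (d\<^sup>2))"
  using assms by (simp add: L2uloc_norm_def SUP_le_iff L2_norm_on_le_iff)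

text \<open>A real bound \<open>d\<close> strictly below \<open>e\<close> lets the argument proceed
  ball by ball with weak inequalities and recover the strict one for the supremum.\<close>

lemma L2uloc_norm_less_real:
  assumes "L2uloc_norm f < ennreal e"
  obtains d where "0 \<le> d" "d < e" "\<forall>x0. sqint (ball x0 1) f \<le> ennreal (d\<^sup>2)"
proof (cases "L2uloc_norm f")
  case (real d)
  then show ?thesis
    using assms that[of d] L2uloc_norm_le_iff[of d f] by (simp add: ennreal_less_iff)
qed (use assms in simp)

text \<open>Total boundedness covers \<open>K\<close> by finitely many unit balls. Their number
  depends on \<open>K\<close> alone, which makes the estimate uniform in \<open>f\<close> and
  \<open>D\<close>.\<close>

lemma sqint_bounded_le:
  fixes K :: "'a::euclidean_space set"
  assumes "bounded K"
  shows "\<exists>N :: nat. \<forall>(f :: 'a \<Rightarrow> 'b::euclidean_space) D. f \<in> borel_measurable lebesgue \<longrightarrow>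
      (\<forall>x0. sqint (ball x0 1) f \<le> D) \<longrightarrow> sqint K f \<le> of_nat N * D"
proof -
  have "compact (closure K)" using assms by (simp add: compact_closure)
  then obtain C where C: "finite C" "closure K \<subseteq> (\<Union>c\<in>C. ball c 1)"
    using compact_eq_totally_bounded[of "closure K"] zero_less_one by blast
  have "sqint K f \<le> of_nat (card C) * D"
    if f[measurable]: "f \<in> borel_measurable lebesgue" and D: "\<And>x0. sqint (ball x0 1) f \<le> D"
    for f :: "'a \<Rightarrow> 'b" and D
  proof -
    have "indicator K x \<le> (\<Sum>c\<in>C. indicator (ball c 1) x :: ennreal)" for x
    proof (cases "x \<in> K")
      case True
      then obtain c where "c \<in> C" "x \<in> ball c 1" using C closure_subset[of K] by blast
      then show ?thesis
        using member_le_sum[of c C "\<lambda>c. indicator (ball c 1) x :: ennreal"] C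
        by (simp add: True)
    qed simp
    then have "sqint K f \<le> (\<integral>\<^sup>+x. (\<Sum>c\<in>C. ennreal ((norm (f x))\<^sup>2) * indicator (ball c 1) x) \<partial>lebesgue)"
      unfolding sum_distrib_left[symmetric] by (intro nn_integral_mono mult_left_mono) auto
    also have "\<dots> = (\<Sum>c\<in>C. sqint (ball c 1) f)"
    proof (rule nn_integral_sum)
      fix c :: 'a
      have [measurable]: "ball c 1 \<in> sets lebesgue" by simp
      show "(\<lambda>x. ennreal ((norm (f x))\<^sup>2) * indicator (ball c 1) x) \<in> borel_measurable lebesgue"
        by measurable
    qed
    also have "\<dots> \<le> of_nat (card C) * D"
      using sum_mono[of C "\<lambda>c. sqint (ball c 1) f" "\<lambda>_. D"] D by simp
    finally show ?thesis .
  qed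
  then show ?thesis by blast
qed

lemma sqint_integral:
  fixes f :: "'a::euclidean_space \<Rightarrow> 'b::euclidean_space"
  assumes f[measurable]: "f \<in> borel_measurable lebesgue" and K[measurable]: "K \<in> sets lebesgue"
    and fin: "sqint K f < \<infinity>"
  shows "set_integrable lebesgue K (\<lambda>x. (norm (f x))\<^sup>2)"
    and "sqint K f = ennreal (LINT x:K|lebesgue. (norm (f x))\<^sup>2)"
proof -
  have eq: "ennreal ((norm (f x))\<^sup>2) * indicator K x = ennreal (indicator K x *\<^sub>R (norm (f x))\<^sup>2)" for x
    by (simp add: indicator_def)
  show *: "set_integrable lebesgue K (\<lambda>x. (norm (f x))\<^sup>2)"
    unfolding set_integrable_def
    using fin unfolding eq by (intro integrableI_nonneg) auto
  show "sqint K f = ennreal (LINT x:K|lebesgue. (norm (f x))\<^sup>2)"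
    unfolding eq set_lebesgue_integral_def
    using * by (intro nn_integral_eq_integral) (auto simp: set_integrable_def)
qed

lemma set_integrable_inner:
  fixes f g :: "'a::euclidean_space \<Rightarrow> 'b::euclidean_space"
  assumes f[measurable]: "f \<in> borel_measurable lebesgue" and g[measurable]: "g \<in> borel_measurable lebesgue"
    and K[measurable]: "K \<in> sets lebesgue"
    and fin: "sqint K f < \<infinity>" "sqint K g < \<infinity>"
  shows "set_integrable lebesgue K (\<lambda>x. f x \<bullet> g x)"
proof -
  have "set_integrable lebesgue K (\<lambda>x. (norm (f x))\<^sup>2 + (norm (g x))\<^sup>2)"
    using fin by (intro set_integral_add(1) sqint_integral) auto
  moreover have "norm (f x \<bullet> g x) \<le> norm ((norm (f x))\<^sup>2 + (norm (g x))\<^sup>2)" for x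
  proof -
    have "\<bar>f x \<bullet> g x\<bar> \<le> norm (f x) * norm (g x)" by (rule Cauchy_Schwarz_ineq2)
    moreover have "2 * (norm (f x) * norm (g x)) \<le> (norm (f x))\<^sup>2 + (norm (g x))\<^sup>2"
      using sum_squares_bound[of "norm (f x)" "norm (g x)"] by (simp add: mult.assoc)
    moreover have "0 \<le> norm (f x) * norm (g x)" by simp
    ultimately show ?thesis unfolding real_norm_def by linarith
  qed
  ultimately show ?thesis
    unfolding set_integrable_def
    by (elim Bochner_Integration.integrable_bound) (auto simp: indicator_def)
qed

section \<open>Test fields: support, boundedness and integrability of pairings\<close>

lemma Cc_inf_support:
  assumes "w \<in> Cc_inf"
  shows "bounded {x \<in> slab. w x \<noteq> 0}" and "{x \<in> slab. w x \<noteq> 0} \<in> sets lebesgue"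
proof -
  have "{x \<in> slab. w x \<noteq> 0} \<subseteq> closure {x. w x \<noteq> 0} \<inter> slab"
    using closure_subset[of "{x. w x \<noteq> 0}"] by auto
  then show "bounded {x \<in> slab. w x \<noteq> 0}"
    by (rule bounded_subset[rotated]) (use assms in \<open>simp add: Cc_inf_def compact_imp_bounded\<close>)
  have "continuous_on UNIV w" using assms by (simp add: Cc_inf_def Cinf_continuous)
  then have [measurable]: "w \<in> borel_measurable borel"
    by (rule borel_measurable_continuous_onI)
  have "{x \<in> slab. w x \<noteq> 0} \<in> sets borel"
    unfolding slab_def by measurable
  then show "{x \<in> slab. w x \<noteq> 0} \<in> sets lebesgue" by simp
qed

lemma Cc_inf_measurable: "w \<in> Cc_inf \<Longrightarrow> w \<in> borel_measurable lebesgue"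
  by (intro measurable_completion)
    (simp add: Cc_inf_def Cinf_continuous borel_measurable_continuous_onI)

lemma Cc_inf_bounded:
  assumes w: "w \<in> Cc_inf"
  obtains M where "0 \<le> M" "\<And>x. norm (w x) \<le> M"
proof -
  let ?K = "closure {x. w x \<noteq> 0} \<inter> slab"
  have per: "periodic3 w" using w by (simp add: Cc_inf_def)
  have "compact (w ` ?K)"
    using w by (intro compact_continuous_image) (simp_all add: Cc_inf_def Cinf_continuous)
  from compact_imp_bounded[OF this] obtain M where M: "0 < M" "\<forall>x\<in>?K. norm (w x) \<le> M"
    unfolding bounded_pos by auto
  have "norm (w x) \<le> M" for x
  proof (cases "w x = 0")
    case False
    obtain k where k: "x + axis 3 (2 * pi * real_of_int k) \<in> slab" (is "?y \<in> _")
      using ex_translate_slab by blast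
    have eq: "w ?y = w x" using periodic3_int[OF per] by simp
    then have "?y \<in> ?K" using False k closure_subset[of "{x. w x \<noteq> 0}"] by auto
    with M(2) have "norm (w ?y) \<le> M" by (rule bspec)
    then show ?thesis by (simp only: eq)
  qed (use M in simp)
  then show ?thesis using M(1) that[of M] by simp
qed

lemma sqint_finite:
  fixes K :: "'a::euclidean_space set"
  assumes K: "bounded K" and M: "\<And>x. x \<in> K \<Longrightarrow> norm (f x) \<le> M"
  shows "sqint K f < \<infinity>"
proof -
  obtain r where r: "K \<subseteq> cball 0 r"
    using K by (auto simp: bounded_iff subset_iff)
  have "sqint K f \<le> (\<integral>\<^sup>+x. ennreal (M\<^sup>2) * indicator (cball (0 :: 'a) r) x \<partial>lebesgue)"
  proof (rule nn_integral_mono)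
    fix x
    show "ennreal ((norm (f x))\<^sup>2) * indicator K x \<le> ennreal (M\<^sup>2) * indicator (cball 0 r) x"
    proof (cases "x \<in> K")
      case True
      then have "(norm (f x))\<^sup>2 \<le> M\<^sup>2" using M by (simp add: power_mono)
      then show ?thesis using True r by (auto simp: ennreal_leI)
    qed simp
  qed
  also have "\<dots> = ennreal (M\<^sup>2) * emeasure lebesgue (cball (0 :: 'a) r)"
    by (rule nn_integral_cmult_indicator) simp
  also have "\<dots> < \<infinity>"
    using lmeasurable_cball[of "0 :: 'a" r]
    by (simp add: fmeasurable_def ennreal_mult_less_top del: emeasure_completion)
  finally show ?thesis .
qed

lemma sqint_finite_continuous:
  assumes "continuous_on UNIV f" and "bounded K"
  shows "sqint K f < \<infinity>"
proof -
  have "compact (f ` closure K)"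
    using assms by (intro compact_continuous_image) (auto intro: continuous_on_subset simp: compact_closure)
  from compact_imp_bounded[OF this] obtain M where "\<forall>x\<in>closure K. norm (f x) \<le> M"
    unfolding bounded_iff by auto
  then show ?thesis
    using closure_subset[of K] by (intro sqint_finite[OF assms(2), of f M]) auto
qed

lemma set_integrable_inner_Cc_inf:
  fixes f :: "real ^ 3 \<Rightarrow> real ^ 3"
  assumes f: "f \<in> borel_measurable lebesgue" and fin: "\<And>K. bounded K \<Longrightarrow> sqint K f < \<infinity>"
    and \<phi>: "\<phi> \<in> Cc_inf"
  shows "set_integrable lebesgue slab (\<lambda>x. f x \<bullet> \<phi> x)"
proof -
  let ?K = "{x \<in> slab. \<phi> x \<noteq> 0}"
  note K = Cc_inf_support[OF \<phi>]
  obtain M where M: "\<And>x. norm (\<phi> x) \<le> M" using Cc_inf_bounded[OF \<phi>] by blast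
  have "sqint ?K \<phi> < \<infinity>"
    using K(1) M by (rule sqint_finite)
  then have "set_integrable lebesgue ?K (\<lambda>x. f x \<bullet> \<phi> x)"
    using f fin K Cc_inf_measurable[OF \<phi>] by (intro set_integrable_inner) auto
  moreover have "indicat_real ?K x *\<^sub>R (f x \<bullet> \<phi> x) = indicat_real slab x *\<^sub>R (f x \<bullet> \<phi> x)" for x
    by (auto simp: indicator_def)
  ultimately show ?thesis by (simp only: set_integrable_def)
qed

text \<open>The squared norm is the smooth function \<open>w x \<bullet> w x\<close>, so it is an
  admissible cut-off, whereas the norm itself need not be smooth.\<close>

lemma Cc_inf_weighted:
  assumes w: "w \<in> Cc_inf" and h: "h \<in> Cc_inf"
  shows "(\<lambda>x. (norm (w x))\<^sup>2 *\<^sub>R h x) \<in> Cc_inf"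
proof -
  have "Cinf (\<lambda>x. (w x \<bullet> w x) *\<^sub>R h x)"
    using w h by (intro Cinf_bounded_bilinear[OF bounded_bilinear_scaleR]
      Cinf_bounded_bilinear[OF bounded_bilinear_inner]) (simp_all add: Cc_inf_def)
  then show ?thesis
    using w h unfolding Cc_inf_iff by (auto simp: periodic3_def power2_norm_eq_inner)
qed

text \<open>Take \<open>|w|^2\<close> as cut-off. Orthogonality of \<open>g\<close> to
  \<open>|w|^2 h\<close> bounds the weighted square integral of \<open>g\<close> by that of
  \<open>g - h\<close>, which is as small as desired; hence \<open>|w| g\<close> vanishes almost
  everywhere on the slab.\<close>

lemma negligible_nonzero_on_support:
  fixes g :: "real ^ 3 \<Rightarrow> real ^ 3"
  assumes w: "w \<in> Cc_inf"
    and g[measurable]: "g \<in> borel_measurable lebesgue"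
    and bnd: "\<And>x0. sqint (ball x0 1) g \<le> ennreal D"
    and orth: "\<And>\<phi>. \<phi> \<in> Cc_inf \<Longrightarrow> (LINT x:slab|lebesgue. g x \<bullet> \<phi> x) = 0"
    and approx: "\<And>\<delta>. \<delta> > 0 \<Longrightarrow> \<exists>h\<in>Cc_inf. \<forall>x0. sqint (ball x0 1) (\<lambda>x. g x - h x) \<le> ennreal \<delta>"
  shows "negligible {x \<in> slab. w x \<noteq> 0 \<and> g x \<noteq> 0}"
proof -
  let ?K = "{x \<in> slab. w x \<noteq> 0}"
  note K = Cc_inf_support[OF w]
  note K(2)[measurable] Cc_inf_measurable[OF w, measurable]
  obtain M where M: "0 \<le> M" "\<And>x. norm (w x) \<le> M" using Cc_inf_bounded[OF w] by blast
  obtain N :: nat where N: "\<And>(f :: real ^ 3 \<Rightarrow> real ^ 3) D. f \<in> borel_measurable lebesgue \<Longrightarrow>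
      (\<And>x0. sqint (ball x0 1) f \<le> D) \<Longrightarrow> sqint ?K f \<le> of_nat N * D"
    using sqint_bounded_le[OF K(1), where 'b = "real ^ 3"] by blast
  \<comment> \<open>Multiplying by the square root of the cut-off turns weighted square integrals
    into plain ones.\<close>
  define wt where "wt f = (\<lambda>x. norm (w x) *\<^sub>R f x)" for f :: "real ^ 3 \<Rightarrow> real ^ 3"
  have wt_le: "sqint ?K (wt f) \<le> ennreal (M\<^sup>2 * (real N * B))"
    if [measurable]: "f \<in> borel_measurable lebesgue" and "\<And>x0. sqint (ball x0 1) f \<le> ennreal B" for f B
  proof -
    have "(norm (w x))\<^sup>2 * (norm (f x))\<^sup>2 \<le> M\<^sup>2 * (norm (f x))\<^sup>2" for x
      using M(2) by (intro mult_right_mono power_mono) simp_all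
    then have "(norm (wt f x))\<^sup>2 \<le> M\<^sup>2 * (norm (f x))\<^sup>2" for x
      by (simp add: wt_def power_mult_distrib)
    then have "sqint ?K (wt f) \<le> (\<integral>\<^sup>+x. ennreal (M\<^sup>2) * (ennreal ((norm (f x))\<^sup>2) * indicator ?K x) \<partial>lebesgue)"
      by (intro nn_integral_mono, unfold mult.assoc[symmetric], intro mult_right_mono)
        (simp_all add: ennreal_mult[symmetric] ennreal_leI)
    also have "\<dots> = ennreal (M\<^sup>2) * sqint ?K f"
      by (rule nn_integral_cmult) measurable
    also have "\<dots> \<le> ennreal (M\<^sup>2) * (of_nat N * ennreal B)"
      using N[of f "ennreal B"] that by (intro mult_left_mono) auto
    also have "\<dots> = ennreal (M\<^sup>2 * (real N * B))"
      by (simp add: ennreal_mult' ennreal_of_nat_eq_real_of_nat)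
    finally show ?thesis .
  qed
  have wt_meas: "wt f \<in> borel_measurable lebesgue" if [measurable]: "f \<in> borel_measurable lebesgue" for f
    unfolding wt_def by measurable
  have small: "sqint ?K (wt g) \<le> ennreal (M\<^sup>2 * (real N * \<delta>))" if pos: "\<delta> > 0" for \<delta>
  proof -
    obtain h where h: "h \<in> Cc_inf" and h_le: "\<And>x0. sqint (ball x0 1) (\<lambda>x. g x - h x) \<le> ennreal \<delta>"
      using approx[OF pos] by blast
    note hm[measurable] = Cc_inf_measurable[OF h]
    let ?e = "\<lambda>x. g x - h x"
    have e[measurable]: "?e \<in> borel_measurable lebesgue" by measurable
    have g_fin: "sqint ?K (wt g) < \<infinity>" and e_fin: "sqint ?K (wt ?e) < \<infinity>"
      using wt_le[OF g bnd] wt_le[OF e h_le] by (auto intro: le_less_trans)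
    note gi = sqint_integral[OF wt_meas[OF g] K(2) g_fin] and ei = sqint_integral[OF wt_meas[OF e] K(2) e_fin]
    have ip: "set_integrable lebesgue ?K (\<lambda>x. wt g x \<bullet> wt ?e x)"
      using g_fin e_fin wt_meas by (intro set_integrable_inner) auto
    have wt_e: "wt ?e x = wt g x - wt h x" for x
      by (simp add: wt_def scaleR_diff_right)
    have he: "wt g x \<bullet> wt h x = (norm (wt g x))\<^sup>2 - wt g x \<bullet> wt ?e x" for x
      by (simp add: wt_e power2_norm_eq_inner inner_diff_right)
    have hi: "set_integrable lebesgue ?K (\<lambda>x. wt g x \<bullet> wt h x)"
      unfolding he using gi(1) ip by (rule set_integral_diff(1))
    have "indicat_real ?K x *\<^sub>R (wt g x \<bullet> wt h x)
        = indicat_real slab x *\<^sub>R (g x \<bullet> ((norm (w x))\<^sup>2 *\<^sub>R h x))" for x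
      by (auto simp: wt_def indicator_def power2_eq_square)
    then have "(LINT x:?K|lebesgue. wt g x \<bullet> wt h x)
        = (LINT x:slab|lebesgue. g x \<bullet> ((norm (w x))\<^sup>2 *\<^sub>R h x))"
      by (simp only: set_lebesgue_integral_def)
    also have "\<dots> = 0"
      by (rule orth[OF Cc_inf_weighted[OF w h]])
    finally have zero: "(LINT x:?K|lebesgue. wt g x \<bullet> wt h x) = 0" .
    \<comment> \<open>With \<open>a = wt g x\<close> and \<open>b = wt h x\<close>, expand
      \<open>|a - b|^2\<close> and discard \<open>- |b|^2\<close>. The inner product term integrates
      to zero.\<close>
    have pt: "(norm (wt g x))\<^sup>2 \<le> 2 * (wt g x \<bullet> wt h x) + (norm (wt ?e x))\<^sup>2" for x
      using dot_norm_neg[of "wt g x" "wt h x"] by (simp add: wt_e field_simps)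
    have hi2: "set_integrable lebesgue ?K (\<lambda>x. 2 * (wt g x \<bullet> wt h x))"
      using hi by (simp add: set_integrable_mult_right)
    have "(LINT x:?K|lebesgue. (norm (wt g x))\<^sup>2)
        \<le> (LINT x:?K|lebesgue. 2 * (wt g x \<bullet> wt h x) + (norm (wt ?e x))\<^sup>2)"
      using gi(1) hi2 ei(1) pt by (intro set_integral_mono set_integral_add(1)) auto
    also have "\<dots> = (LINT x:?K|lebesgue. (norm (wt ?e x))\<^sup>2)"
      using hi2 ei(1) zero by (simp add: set_integral_add(2))
    finally have "sqint ?K (wt g) \<le> sqint ?K (wt ?e)"
      unfolding gi(2) ei(2) by (rule ennreal_leI)
    also have "\<dots> \<le> ennreal (M\<^sup>2 * (real N * \<delta>))"
      using wt_le[OF e h_le] .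
    finally show ?thesis .
  qed
  have "sqint ?K (wt g) \<le> 0"
  proof (rule ennreal_le_epsilon)
    fix e :: real assume "0 < e"
    \<comment> \<open>The summand 1 keeps the divisor positive when \<open>M\<close> or
      \<open>N\<close> is zero.\<close>
    let ?c = "M\<^sup>2 * real N + 1"
    have c: "?c > 0" using M by (intro add_nonneg_pos) auto
    have "M\<^sup>2 * (real N * (e / ?c)) \<le> e"
      using c \<open>0 < e\<close> by (simp add: field_simps)
    then have "sqint ?K (wt g) \<le> ennreal e"
      using small[of "e / ?c"] c \<open>0 < e\<close> by (auto intro: order_trans ennreal_leI)
    then show "sqint ?K (wt g) \<le> 0 + ennreal e" by simp
  qed
  moreover have [measurable]: "wt g \<in> borel_measurable lebesgue" by (rule wt_meas) fact
  ultimately have "AE x in lebesgue. ennreal ((norm (wt g x))\<^sup>2) * indicator ?K x = 0"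
    by (subst (asm) le_zero_eq, subst (asm) nn_integral_0_iff_AE) auto
  then have "AE x in lebesgue. x \<notin> {x \<in> slab. w x \<noteq> 0 \<and> g x \<noteq> 0}"
    by eventually_elim (auto simp: wt_def indicator_def)
  then show ?thesis
    by (simp add: negligible_iff_null_sets completion.AE_iff_null_sets)
qed

section \<open>Almost everywhere invariance of helical fields\<close>

lemma Cc_inf_translate:
  assumes w: "w \<in> Cc_inf"
  shows "(\<lambda>x. w (x + c)) \<in> Cc_inf"
proof -
  obtain R where R: "\<And>x. w x \<noteq> 0 \<Longrightarrow> (x $ 1)\<^sup>2 + (x $ 2)\<^sup>2 \<le> R"
    using w by (auto simp: Cc_inf_iff)
  have "Cinf (\<lambda>x :: real ^ 3. x + c)"
    by (intro Cinf_add Cinf_const Cinf_bounded_linear bounded_linear_ident)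
  then have "Cinf (\<lambda>x. w (x + c))"
    using w by (intro Cinf_compose[where f = w and g = "\<lambda>x. x + c"]) (simp_all add: Cc_inf_def)
  moreover have "w (x + axis 3 (2 * pi) + c) = w (x + c)" for x
  proof -
    have "x + axis 3 (2 * pi) + c = (x + c) + axis 3 (2 * pi)" by simp
    then show ?thesis using w by (simp only: Cc_inf_def periodic3_def mem_Collect_eq)
  qed
  \<comment> \<open>The constant comes from \<open>a^2 <= 2 (a + b)^2 + 2 b^2\<close>, which is
    \<open>(a + 2 b)^2 >= 0\<close> rearranged.\<close>
  moreover have "(x $ 1)\<^sup>2 + (x $ 2)\<^sup>2 \<le> 2 * R + 2 * ((c $ 1)\<^sup>2 + (c $ 2)\<^sup>2)" if "w (x + c) \<noteq> 0" for x
  proof -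
    have "(a :: real)\<^sup>2 \<le> 2 * (a + b)\<^sup>2 + 2 * b\<^sup>2" for a b
      using zero_le_power2[of "a + 2 * b"] by (simp add: power2_eq_square algebra_simps)
    from this[of "x $ 1" "c $ 1"] this[of "x $ 2" "c $ 2"] show ?thesis
      using R[OF that] by simp
  qed
  ultimately show ?thesis
    unfolding Cc_inf_iff periodic3_def by blast
qed

text \<open>Translates of a single nonzero test field are nonvanishing near any prescribed point. So
  the nonzero set of \<open>g\<close> in the slab is locally negligible, hence negligible, and
  periodicity carries this to the whole space.\<close>

lemma AE_eq_0_if_orthogonal:
  fixes g :: "real ^ 3 \<Rightarrow> real ^ 3"
  assumes w: "w \<in> Cc_inf" "w a \<noteq> 0" and per: "periodic3 g"
    and g: "g \<in> borel_measurable lebesgue"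
    and bnd: "\<And>x0. sqint (ball x0 1) g \<le> ennreal D"
    and orth: "\<And>\<phi>. \<phi> \<in> Cc_inf \<Longrightarrow> (LINT x:slab|lebesgue. g x \<bullet> \<phi> x) = 0"
    and approx: "\<And>\<delta>. \<delta> > 0 \<Longrightarrow> \<exists>h\<in>Cc_inf. \<forall>x0. sqint (ball x0 1) (\<lambda>x. g x - h x) \<le> ennreal \<delta>"
  shows "AE x in lebesgue. g x = 0"
proof -
  let ?S = "{x \<in> slab. g x \<noteq> 0}"
  have "negligible ?S"
  proof (subst locally_negligible_alt, rule ballI)
    fix b assume b: "b \<in> ?S"
    \<comment> \<open>The shift moves the point \<open>a\<close>, where \<open>w\<close> is nonzero,
      to \<open>b\<close>.\<close>
    let ?w = "\<lambda>x. w (x + (a - b))"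
    have w': "?w \<in> Cc_inf" by (rule Cc_inf_translate[OF w(1)])
    then have "continuous_on UNIV ?w" by (simp add: Cc_inf_def Cinf_continuous)
    then have "open {x. ?w x \<noteq> 0}"
      by (intro open_Collect_neq continuous_on_const)
    then have "openin (top_of_set ?S) (?S \<inter> {x. ?w x \<noteq> 0})"
      by (rule openin_open_Int)
    moreover have "b \<in> ?S \<inter> {x. ?w x \<noteq> 0}"
      using b w(2) by simp
    moreover have "negligible {x \<in> slab. ?w x \<noteq> 0 \<and> g x \<noteq> 0}"
      using w' g bnd orth approx by (rule negligible_nonzero_on_support)
    then have "negligible (?S \<inter> {x. ?w x \<noteq> 0})"
      by (rule negligible_subset) auto
    ultimately show "\<exists>U. openin (top_of_set ?S) U \<and> b \<in> U \<and> negligible U"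
      by (intro exI[of _ "?S \<inter> {x. ?w x \<noteq> 0}"] conjI)
  qed
  \<comment> \<open>Countably many vertical translates of the exceptional set in the slab exhaust
    the one in space.\<close>
  let ?T = "\<lambda>k :: int. (+) (axis 3 (2 * pi * real_of_int (- k))) ` ?S"
  have "negligible (\<Union>(range ?T))"
    using \<open>negligible ?S\<close> by (intro negligible_countable_Union) (auto intro: negligible_translation)
  moreover have "{x. g x \<noteq> 0} \<subseteq> \<Union>(range ?T)"
  proof
    fix x assume "x \<in> {x. g x \<noteq> 0}"
    moreover obtain k where "x + axis 3 (2 * pi * real_of_int k) \<in> slab"
      using ex_translate_slab by blast
    ultimately have "x + axis 3 (2 * pi * real_of_int k) \<in> ?S"
      using periodic3_int[OF per] by simp
    moreover have "x = axis 3 (2 * pi * real_of_int (- k)) + (x + axis 3 (2 * pi * real_of_int k))"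
      by (simp add: vec_eq_iff axis_def)
    ultimately have "x \<in> ?T k" by (rule rev_image_eqI)
    then show "x \<in> \<Union>(range ?T)" by blast
  qed
  ultimately have "negligible {x. g x \<noteq> 0}"
    by (rule negligible_subset)
  then show ?thesis
    by (simp add: negligible_iff_null_sets completion.AE_iff_null_sets)
qed

section \<open>The screw action on measurable fields\<close>

lemma screw_field_measurable:
  assumes "f \<in> borel_measurable lebesgue"
  shows "screw_field t f \<in> borel_measurable lebesgue"
proof -
  have "(\<lambda>x. f (screw t x)) \<in> borel_measurable lebesgue"
    using measurable_compose[OF screw_measurable assms] .
  moreover have "(*v) (rot3 (- t)) \<in> borel_measurable borel"
    by (intro borel_measurable_continuous_onI linear_continuous_on matrix_vector_mul_bounded_linear)
  ultimately show ?thesis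
    unfolding screw_field_def[abs_def] by (rule measurable_compose)
qed

text \<open>Screw motions preserve measure and carry balls to balls, and rotations preserve the
  norm. Bounds uniform over all unit balls are therefore invariant under the action.\<close>

lemma sqint_ball_screw_field:
  assumes [measurable]: "f \<in> borel_measurable lebesgue"
  shows "sqint (ball x0 r) (screw_field t f) = sqint (ball (screw t x0) r) f"
  by (simp add: screw_field_def nn_integral_ball_screw[where f = "\<lambda>x. ennreal ((norm (f x))\<^sup>2)", symmetric])

lemma sqint_diff_le:
  fixes f g :: "'a::euclidean_space \<Rightarrow> 'b::euclidean_space"
  assumes [measurable]: "f \<in> borel_measurable lebesgue" "g \<in> borel_measurable lebesgue" "A \<in> sets lebesgue"
  shows "sqint A (\<lambda>x. f x - g x) \<le> 2 * sqint A f + 2 * sqint A g"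
proof -
  have "(norm (f x - g x))\<^sup>2 \<le> 2 * (norm (f x))\<^sup>2 + 2 * (norm (g x))\<^sup>2" for x
    using zero_le_power2[of "norm (f x + g x)"] unfolding power2_norm_eq_inner
    by (simp add: inner_diff_left inner_diff_right inner_add_left inner_add_right inner_commute[of "g x" "f x"])
  then have "ennreal ((norm (f x - g x))\<^sup>2) \<le> 2 * ennreal ((norm (f x))\<^sup>2) + 2 * ennreal ((norm (g x))\<^sup>2)" for x
    by (simp add: ennreal_plus[symmetric] ennreal_mult'[symmetric] ennreal_leI del: ennreal_plus
        flip: ennreal_numeral)
  then have "sqint A (\<lambda>x. f x - g x) \<le> (\<integral>\<^sup>+x. 2 * (ennreal ((norm (f x))\<^sup>2) * indicator A x)
      + 2 * (ennreal ((norm (g x))\<^sup>2) * indicator A x) \<partial>lebesgue)"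
    by (intro nn_integral_mono) (simp add: indicator_def)
  also have "\<dots> = 2 * sqint A f + 2 * sqint A g"
    by (simp add: nn_integral_add nn_integral_cmult)
  finally show ?thesis .
qed

lemma slab_inner_screw_field:
  fixes f \<phi> :: "real ^ 3 \<Rightarrow> real ^ 3"
  assumes "periodic3 f" "periodic3 \<phi>" and t: "0 \<le> t" "t \<le> 2 * pi"
    and int: "set_integrable lebesgue slab (\<lambda>x. f x \<bullet> \<phi> x)"
  shows "(LINT x:slab|lebesgue. screw_field t f x \<bullet> screw_field t \<phi> x) = (LINT x:slab|lebesgue. f x \<bullet> \<phi> x)"
proof -
  have "periodic3 (\<lambda>x. f x \<bullet> \<phi> x)"
    using assms by (simp add: periodic3_def)
  from slab_integral_screw(2)[OF this int t] show ?thesis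
    by (simp add: screw_field_def)
qed

lemma L2uloc_bound:
  assumes "u \<in> L2uloc"
  obtains D where "\<And>x0. sqint (ball x0 1) u \<le> ennreal D"
proof (cases "L2uloc_norm u")
  case (real r)
  then have "L2uloc_norm u < ennreal (r + 1)" by (simp add: ennreal_less_iff)
  then obtain d where "\<forall>x0. sqint (ball x0 1) u \<le> ennreal (d\<^sup>2)"
    by (rule L2uloc_norm_less_real)
  then show ?thesis by (intro that) auto
qed (use assms in \<open>simp add: L2uloc_def\<close>)

lemma L2uloc_sqint_finite:
  assumes u: "u \<in> L2uloc" and "bounded K"
  shows "sqint K u < \<infinity>"
proof -
  obtain D where D: "\<And>x0. sqint (ball x0 1) u \<le> ennreal D"
    using L2uloc_bound[OF u] by blast
  obtain N :: nat where "\<And>(f :: real ^ 3 \<Rightarrow> real ^ 3) D. f \<in> borel_measurable lebesgue \<Longrightarrow>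
      (\<And>x0. sqint (ball x0 1) f \<le> D) \<Longrightarrow> sqint K f \<le> of_nat N * D"
    using sqint_bounded_le[OF assms(2), where 'b = "real ^ 3"] by blast
  from this[of u "ennreal D"] have "sqint K u \<le> of_nat N * ennreal D"
    using u D by (simp add: L2uloc_def)
  also have "\<dots> < \<infinity>" by (simp add: ennreal_mult_less_top of_nat_less_top)
  finally show ?thesis .
qed

text \<open>Each helical \<open>v n\<close> has the same pairing with a test field and with its
  transform by \<open>- t\<close>; the limit \<open>u\<close> inherits this, so
  \<open>u - U\<^sub>t u\<close> is orthogonal to all test fields. It is approximated by
  \<open>z - U\<^sub>t z\<close> with \<open>z\<close> a test field close to \<open>u\<close>. The
  nonzero \<open>w\<close> supplies the cut-offs.\<close>

lemma AE_screw_field_eq: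
  assumes u: "u \<in> E2_ring" and hel: "helical_distr u"
    and w: "w \<in> Cc_inf" "w a \<noteq> 0" and t: "0 \<le> t" "t \<le> 2 * pi"
  shows "AE x in lebesgue. screw_field t u x = u x"
proof -
  let ?U = "screw_field t"
  have uL: "u \<in> L2uloc" using u by (simp add: E2_ring_def)
  have um[measurable]: "u \<in> borel_measurable lebesgue" and up: "periodic3 u"
    using uL by (simp_all add: L2uloc_def)
  have Um[measurable]: "?U u \<in> borel_measurable lebesgue"
    by (rule screw_field_measurable[OF um])
  obtain D where D: "\<And>x0. sqint (ball x0 1) u \<le> ennreal D"
    using L2uloc_bound[OF uL] by blast
  \<comment> \<open>The factor 4 arises from \<open>|a - b|^2 <= 2 |a|^2 + 2 |b|^2\<close> and the
    same bound \<open>B\<close> for \<open>f\<close> and \<open>?U f\<close>.\<close>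
  have diff: "sqint (ball x0 1) (\<lambda>x. f x - ?U f x) \<le> ennreal (4 * B)"
    if [measurable]: "f \<in> borel_measurable lebesgue" and B: "\<And>x0. sqint (ball x0 1) f \<le> ennreal B" for f B x0
  proof -
    have "sqint (ball x0 1) (\<lambda>x. f x - ?U f x) \<le> 2 * sqint (ball x0 1) f + 2 * sqint (ball x0 1) (?U f)"
      by (intro sqint_diff_le screw_field_measurable that) simp
    also have "\<dots> \<le> 2 * ennreal B + 2 * ennreal B"
      unfolding sqint_ball_screw_field[OF that(1)] by (intro add_mono mult_left_mono B) auto
    also have "\<dots> = 4 * ennreal B"
      by (simp flip: distrib_right)
    also have "\<dots> = ennreal (4 * B)"
      by (simp add: ennreal_mult')
    finally show ?thesis .
  qed
  have int: "set_integrable lebesgue slab (\<lambda>x. u x \<bullet> \<phi> x)" if "\<phi> \<in> Cc_inf" for \<phi>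
    using um L2uloc_sqint_finite[OF uL] that by (rule set_integrable_inner_Cc_inf)
  have intU: "set_integrable lebesgue slab (\<lambda>x. ?U u x \<bullet> \<phi> x)" if "\<phi> \<in> Cc_inf" for \<phi>
  proof -
    \<comment> \<open>Writing the test field as a transform makes the pairing a screwed periodic
      function, whose integrability over the slab is known.\<close>
    have "\<phi> = ?U (screw_field (- t) \<phi>)" by (simp add: screw_field_add)
    moreover have "periodic3 (\<lambda>x. u x \<bullet> screw_field (- t) \<phi> x)"
      using up screw_field_Cc_inf[OF that, of "- t"] by (simp add: periodic3_def Cc_inf_def)
    from slab_integral_screw(1)[OF this int[OF screw_field_Cc_inf[OF that]] t]
    have "set_integrable lebesgue slab (\<lambda>x. ?U u x \<bullet> ?U (screw_field (- t) \<phi>) x)"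
      by (simp add: screw_field_def[of t])
    ultimately show ?thesis by simp
  qed
  obtain v where v: "\<And>n. Cinf (v n)" "\<And>n. helical (v n)"
    and lim: "\<And>\<phi>. \<phi> \<in> Cc_inf \<Longrightarrow> (\<lambda>n. LINT x:slab|lebesgue. v n x \<bullet> \<phi> x)
        \<longlonglongrightarrow> (LINT x:slab|lebesgue. u x \<bullet> \<phi> x)"
    using hel unfolding helical_distr_def by blast
  have orth: "(LINT x:slab|lebesgue. (u x - ?U u x) \<bullet> \<phi> x) = 0" if \<phi>: "\<phi> \<in> Cc_inf" for \<phi>
  proof -
    let ?\<psi> = "screw_field (- t) \<phi>"
    have \<psi>: "?\<psi> \<in> Cc_inf" by (rule screw_field_Cc_inf[OF \<phi>])
    have per: "periodic3 ?\<psi>" using \<psi> by (simp add: Cc_inf_def)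
    have U: "?U ?\<psi> = \<phi>" by (simp add: screw_field_add)
    have "(LINT x:slab|lebesgue. v n x \<bullet> \<phi> x) = (LINT x:slab|lebesgue. v n x \<bullet> ?\<psi> x)" for n
    proof -
      have c: "continuous_on UNIV (v n)" using v(1) by (rule Cinf_continuous)
      have "v n \<in> borel_measurable lebesgue"
        by (intro measurable_completion) (use c in \<open>simp add: borel_measurable_continuous_onI\<close>)
      then have "set_integrable lebesgue slab (\<lambda>x. v n x \<bullet> ?\<psi> x)"
        using sqint_finite_continuous[OF c] \<psi> by (rule set_integrable_inner_Cc_inf)
      from slab_inner_screw_field[OF helical_imp_periodic3[OF v(2)] per t this]
      show ?thesis using v(2)[of n] by (simp add: U helical_iff_screw_field)
    qed
    then have "(LINT x:slab|lebesgue. u x \<bullet> \<phi> x) = (LINT x:slab|lebesgue. u x \<bullet> ?\<psi> x)"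
      using lim[OF \<phi>] lim[OF \<psi>] by (simp add: LIMSEQ_unique)
    also have "\<dots> = (LINT x:slab|lebesgue. ?U u x \<bullet> \<phi> x)"
      using slab_inner_screw_field[OF up per t int[OF \<psi>]] by (simp add: U)
    finally show ?thesis
      using set_integral_diff(2)[OF int[OF \<phi>] intU[OF \<phi>]] by (simp add: inner_diff_left)
  qed
  have approx: "\<exists>h\<in>Cc_inf. \<forall>x0. sqint (ball x0 1) (\<lambda>x. (u x - ?U u x) - h x) \<le> ennreal \<delta>"
    if "\<delta> > 0" for \<delta>
  proof -
    \<comment> \<open>Squaring gives \<open>\<delta> / 4\<close> on each ball, and the factor 4 in
      \<open>diff\<close> then returns \<open>\<delta>\<close>.\<close>
    have "sqrt (\<delta> / 4) > 0" using that by simp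
    moreover have "\<forall>d>0. \<exists>z\<in>Cc_inf. L2uloc_norm (\<lambda>x. u x - z x) < ennreal d"
      using u by (auto simp: E2_ring_def)
    ultimately obtain z where z: "z \<in> Cc_inf" "L2uloc_norm (\<lambda>x. u x - z x) < ennreal (sqrt (\<delta> / 4))"
      by blast
    note zm[measurable] = Cc_inf_measurable[OF z(1)]
    let ?f = "\<lambda>x. u x - z x"
    have fm: "?f \<in> borel_measurable lebesgue" by measurable
    have f: "sqint (ball x0 1) ?f \<le> ennreal (\<delta> / 4)" for x0
      using L2uloc_norm_le_iff[of "sqrt (\<delta> / 4)" ?f] less_imp_le[OF z(2)] that by simp
    have eq: "?f x - ?U ?f x = (u x - ?U u x) - (z x - ?U z x)" for x
      by (simp add: screw_field_def matrix_vector_mult_diff_distrib)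
    have "Cinf (\<lambda>x. z x + - ?U z x)"
      using z(1) screw_field_Cc_inf[OF z(1), of t]
      by (intro Cinf_add Cinf_compose[OF Cinf_bounded_linear[OF bounded_linear_minus[OF bounded_linear_ident]]])
        (simp_all add: Cc_inf_def)
    moreover obtain R R' where "\<And>x. z x \<noteq> 0 \<Longrightarrow> (x $ 1)\<^sup>2 + (x $ 2)\<^sup>2 \<le> R"
        "\<And>x. ?U z x \<noteq> 0 \<Longrightarrow> (x $ 1)\<^sup>2 + (x $ 2)\<^sup>2 \<le> R'"
      using z(1) screw_field_Cc_inf[OF z(1), of t] unfolding Cc_inf_iff by blast
    then have "\<And>x. z x - ?U z x \<noteq> 0 \<Longrightarrow> (x $ 1)\<^sup>2 + (x $ 2)\<^sup>2 \<le> max R R'"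
      by (metis diff_0_right diff_self max.coboundedI1 max.coboundedI2)
    moreover have "periodic3 (\<lambda>x. z x - ?U z x)"
      using z(1) screw_field_Cc_inf[OF z(1), of t] by (simp add: Cc_inf_def periodic3_def)
    ultimately have "(\<lambda>x. z x - ?U z x) \<in> Cc_inf"
      unfolding Cc_inf_iff by auto
    moreover have "\<forall>x0. sqint (ball x0 1) (\<lambda>x. (u x - ?U u x) - (z x - ?U z x)) \<le> ennreal \<delta>"
      using diff[OF fm f] unfolding eq by simp
    ultimately show ?thesis by (intro bexI[of _ "\<lambda>x. z x - ?U z x"])
  qed
  have "periodic3 (\<lambda>x. u x - ?U u x)"
    using up periodic3_screw_field[OF up, of t] by (simp add: periodic3_def)
  moreover have "(\<lambda>x. u x - ?U u x) \<in> borel_measurable lebesgue" by measurable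
  ultimately have "AE x in lebesgue. u x - ?U u x = 0"
    using diff[OF um D] orth approx by (intro AE_eq_0_if_orthogonal[OF w]) auto
  then show ?thesis by eventually_elim simp
qed

section \<open>Averaging over the screw motions\<close>

definition screw_average :: "(real ^ 3 \<Rightarrow> real ^ 3) \<Rightarrow> real ^ 3 \<Rightarrow> real ^ 3" where
  "screw_average w x = (1 / (2 * pi)) *\<^sub>R integral {0..2 * pi} (\<lambda>t. screw_field t w x)"

lemma continuous_screw_field_param:
  assumes "Cinf w"
  shows "continuous_on A (\<lambda>t. screw_field t w x)"
proof -
  have "continuous_on A (\<lambda>t. (\<lambda>p. screw_field (fst p) w (snd p)) (t, x))"
    by (rule continuous_on_compose2[OF Cinf_continuous[OF Cinf_screw_field_joint[OF assms], of UNIV]])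
      (auto intro: continuous_on_Pair)
  then show ?thesis by simp
qed

lemma Cinf_screw_average:
  assumes "Cinf w"
  shows "Cinf (screw_average w)"
proof -
  have "Cinf (\<lambda>x. (1 / (2 * pi)) *\<^sub>R integral {0..2 * pi} (\<lambda>t. screw_field (fst (t, x)) w (snd (t, x))))"
    by (intro Cinf_bounded_bilinear[OF bounded_bilinear_scaleR] Cinf_const
        Cinf_integral_parameter[OF Cinf_screw_field_joint[OF assms]])
  then show ?thesis by (simp add: screw_average_def[abs_def])
qed

section \<open>The average is a helical test field\<close>

lemma integral_periodic_shift:
  fixes q :: "real \<Rightarrow> 'a::euclidean_space"
  assumes q: "continuous_on UNIV q" and per: "\<And>t. q (t + p) = q t" and s: "0 \<le> s" "s \<le> p"
  shows "integral {0..p} (\<lambda>t. q (t + s)) = integral {0..p} q"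
proof -
  have int: "q integrable_on {a..b}" for a b
    using q by (intro integrable_continuous_interval) (rule continuous_on_subset, auto)
  have "integral {0..p} (\<lambda>t. q (t + s)) = integral {s..p + s} q"
    using integral_shift_Icc_real[of 0 p q s] by (simp add: o_def add.commute)
  also have "\<dots> = integral {s..p} q + integral {p..p + s} q"
    using s int by (simp add: Henstock_Kurzweil_Integration.integral_combine)
  also have "integral {p..p + s} q = integral {0..s} (\<lambda>t. q (t + p))"
    using integral_shift_Icc_real[of 0 s q p] by (simp add: o_def add.commute)
  also have "\<dots> = integral {0..s} q" by (simp add: per)
  also have "integral {s..p} q + integral {0..s} q = integral {0..p} q"
    using s int Henstock_Kurzweil_Integration.integral_combine[of 0 s p q] by (simp add: add.commute)
  finally show ?thesis .
qed

text \<open>The group law turns the action by \<open>s\<close> into a shift of the integration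
  variable, which leaves the integral over a full period unchanged.\<close>

lemma screw_field_screw_average:
  assumes w: "w \<in> Cc_inf" and s: "0 \<le> s" "s \<le> 2 * pi"
  shows "screw_field s (screw_average w) = screw_average w"
proof
  fix x
  have Cw: "Cinf w" and pw: "periodic3 w" using w by (simp_all add: Cc_inf_def)
  let ?q = "\<lambda>t. screw_field t w x"
  have "screw_field s (screw_average w) x
      = (1 / (2 * pi)) *\<^sub>R (rot3 (- s) *v integral {0..2 * pi} (\<lambda>t. screw_field t w (screw s x)))"
    by (simp add: screw_field_def[of s "screw_average w"] screw_average_def matrix_vector_mult_scaleR)
  also have "rot3 (- s) *v integral {0..2 * pi} (\<lambda>t. screw_field t w (screw s x))
      = integral {0..2 * pi} (\<lambda>t. rot3 (- s) *v screw_field t w (screw s x))"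
    by (rule integral_linear[OF integrable_continuous_interval matrix_vector_mul_bounded_linear,
        unfolded o_def, symmetric]) (rule continuous_screw_field_param[OF Cw])
  also have "(\<lambda>t. rot3 (- s) *v screw_field t w (screw s x)) = (\<lambda>t. ?q (t + s))"
    using screw_field_add[of s _ w] by (simp add: fun_eq_iff screw_field_def[of s] add.commute)
  also have "integral {0..2 * pi} (\<lambda>t. ?q (t + s)) = integral {0..2 * pi} ?q"
    using s by (intro integral_periodic_shift continuous_screw_field_param Cw)
      (simp_all add: screw_field_2pi[OF pw])
  finally show "screw_field s (screw_average w) x = screw_average w x"
    unfolding screw_average_def[of w x] .
qed

text \<open>Every \<open>t\<close> is a multiple of a parameter in the unit interval, up to sign,
  and the group law passes invariance to multiples and inverses.\<close>

lemma helicalI_small: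
  assumes small: "\<And>s. 0 \<le> s \<Longrightarrow> s \<le> 1 \<Longrightarrow> screw_field s v = v"
  shows "helical v"
  unfolding helical_iff_screw_field
proof
  fix t :: real
  \<comment> \<open>The added 1 keeps \<open>n\<close> positive for \<open>t = 0\<close>, so that
    \<open>n\<close> copies of \<open>\<bar>t\<bar> / real n\<close> make up
    \<open>\<bar>t\<bar>\<close>.\<close>
  define n where "n = nat \<lceil>\<bar>t\<bar>\<rceil> + 1"
  have n: "\<bar>t\<bar> \<le> real n" "n > 0" unfolding n_def by linarith+
  have mult: "screw_field (real m * r) v = v" if "0 \<le> r" "r \<le> 1" for m r
  proof (induction m)
    case (Suc m)
    have "screw_field (real (Suc m) * r) v = screw_field r (screw_field (real m * r) v)"
      by (simp add: screw_field_add algebra_simps)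
    then show ?case using Suc small[OF that] by simp
  qed simp
  have abs: "screw_field \<bar>t\<bar> v = v"
    using mult[of "\<bar>t\<bar> / real n" n] n by simp
  show "screw_field t v = v"
  proof (cases "0 \<le> t")
    case False
    have "screw_field t v = screw_field t (screw_field \<bar>t\<bar> v)" by (simp only: abs)
    also have "\<dots> = v" using False by (simp add: screw_field_add)
    finally show ?thesis .
  qed (use abs in simp)
qed

lemma helical_screw_average: "w \<in> Cc_inf \<Longrightarrow> helical (screw_average w)"
  using pi_gt3 by (intro helicalI_small screw_field_screw_average) auto

text \<open>Screw motions keep the distance from the vertical axis, so the average is supported in
  the same cylinder as \<open>w\<close>.\<close>

lemma screw_average_Cc_inf:
  assumes w: "w \<in> Cc_inf"
  shows "screw_average w \<in> Cc_inf"
proof -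
  obtain R where R: "\<And>x. w x \<noteq> 0 \<Longrightarrow> (x $ 1)\<^sup>2 + (x $ 2)\<^sup>2 \<le> R"
    using w by (auto simp: Cc_inf_iff)
  have "(x $ 1)\<^sup>2 + (x $ 2)\<^sup>2 \<le> R" if "screw_average w x \<noteq> 0" for x
  proof (rule ccontr)
    assume "\<not> ?thesis"
    then have "w (screw t x) = 0" for t
      using R[of "screw t x"] by (auto simp: screw_horizontal)
    then have "screw_field t w x = 0" for t by (simp add: screw_field_def)
    then show False using that by (simp add: screw_average_def)
  qed
  then show ?thesis
    unfolding Cc_inf_iff using w helical_imp_periodic3[OF helical_screw_average[OF w]]
    by (auto simp: Cc_inf_def intro: Cinf_screw_average)
qed

text \<open>The divergence passes under the integral, where it becomes the divergence of
  \<open>w\<close> along the orbit of \<open>x\<close>, which is zero.\<close>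

lemma divergence_free_screw_average:
  assumes w: "Cinf w" and div: "divergence_free w"
  shows "divergence_free (screw_average w)"
  unfolding divergence_free_def
proof
  fix x :: "real ^ 3"
  let ?F = "\<lambda>p. screw_field (fst p) w (snd p)"
  let ?D = "\<lambda>i t. frechet_derivative ?F (at (t, x)) (0, axis i 1)"
  have F: "Cinf ?F" by (rule Cinf_screw_field_joint[OF w])
  then have C1: "Ck 1 ?F" by (simp only: Cinf_def)
  have "((\<lambda>x. (1 / (2 * pi)) *\<^sub>R integral {0..2 * pi} (\<lambda>t. ?F (t, x))) has_derivative
      (\<lambda>h. (1 / (2 * pi)) *\<^sub>R integral {0..2 * pi} (\<lambda>t. frechet_derivative ?F (at (t, x)) (0, h)))) (at x)"
    by (intro has_derivative_scaleR_right has_derivative_integral_parameter[OF C1])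
  then have "(screw_average w has_derivative
      (\<lambda>h. (1 / (2 * pi)) *\<^sub>R integral {0..2 * pi} (\<lambda>t. frechet_derivative ?F (at (t, x)) (0, h)))) (at x)"
    by (simp add: screw_average_def[abs_def])
  from fun_cong[OF frechet_derivative_at[OF this, symmetric]]
  have D: "frechet_derivative (screw_average w) (at x) (axis i 1)
      = (1 / (2 * pi)) *\<^sub>R integral {0..2 * pi} (?D i)" for i .
  \<comment> \<open>Links the joint derivative produced by the parameter integral to the field at
    fixed \<open>t\<close>, for which the divergence formula is available.\<close>
  have slice: "?D i t = frechet_derivative (screw_field t w) (at x) (axis i 1)" for i t
  proof -
    have "((\<lambda>x. (t, x)) has_derivative (\<lambda>h. (0, h))) (at x)"
      by (auto intro!: derivative_eq_intros)
    from has_derivative_compose[OF this Cinf_has_derivative[OF F]]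
    have "(screw_field t w has_derivative (\<lambda>h. frechet_derivative ?F (at (t, x)) (0, h))) (at x)"
      by simp
    from fun_cong[OF frechet_derivative_at[OF this]] show ?thesis .
  qed
  have int: "?D i integrable_on {0..2 * pi}" for i
  proof -
    have "(0, axis i 1) \<in> (Basis :: (real \<times> (real ^ 3)) set)"
      by (simp add: Basis_prod_def axis_in_Basis_iff)
    then have "continuous_on UNIV (\<lambda>p. frechet_derivative ?F (at p) (0, axis i 1))"
      using C1 by auto
    then have "continuous_on {0..2 * pi} (\<lambda>t. (\<lambda>p. frechet_derivative ?F (at p) (0, axis i 1)) (t, x))"
      by (rule continuous_on_compose2) (auto intro: continuous_on_Pair)
    then show ?thesis by (intro integrable_continuous_interval) simp
  qed
  have "divergence (screw_average w) x
      = (1 / (2 * pi)) * (\<Sum>i\<in>UNIV. integral {0..2 * pi} (\<lambda>t. ?D i t $ i))"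
    unfolding divergence_def D
    using int by (simp add: sum_distrib_left integral_component_eq_cart)
  also have "(\<Sum>i\<in>UNIV. integral {0..2 * pi} (\<lambda>t. ?D i t $ i))
      = integral {0..2 * pi} (\<lambda>t. \<Sum>i\<in>UNIV. ?D i t $ i)"
    using integrable_component[OF int] by (intro integral_sum[symmetric]) (auto simp: cart_eq_inner_axis axis_in_Basis_iff)
  also have "(\<lambda>t. \<Sum>i\<in>UNIV. ?D i t $ i) = (\<lambda>t. divergence w (screw t x))"
    unfolding slice divergence_def[symmetric] divergence_screw_field[OF w] ..
  also have "integral {0..2 * pi} (\<lambda>t. divergence w (screw t x)) = 0"
    using div by (simp add: divergence_free_def)
  finally show "divergence (screw_average w) x = 0" by simp
qed

section \<open>The average is no farther from the given field\<close>

text \<open>Jensen's inequality for the squared norm. With \<open>m\<close> the mean of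
  \<open>q\<close>, it follows by integrating the tangent inequality
  \<open>2 (q \<bullet> m) - m \<bullet> m <= |q|^2\<close> over one period.\<close>

lemma norm_diff_screw_average_le:
  assumes w: "Cinf w"
  shows "ennreal ((norm (a - screw_average w x))\<^sup>2)
    \<le> ennreal (1 / (2 * pi)) * (\<integral>\<^sup>+t\<in>{0..2 * pi}. ennreal ((norm (a - screw_field t w x))\<^sup>2) \<partial>lborel)"
proof -
  let ?q = "\<lambda>t. a - screw_field t w x" and ?I = "{0..2 * pi}"
  define m where "m = a - screw_average w x"
  have c: "continuous_on ?I (\<lambda>t. screw_field t w x)" by (rule continuous_screw_field_param[OF w])
  have "integral ?I ?q = integral ?I (\<lambda>t. a) - integral ?I (\<lambda>t. screw_field t w x)"
    using c by (intro integral_diff integrable_continuous_interval) (auto intro: continuous_intros)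
  then have m: "integral ?I ?q = (2 * pi) *\<^sub>R m"
    by (simp add: m_def screw_average_def scaleR_diff_right)
  have cq: "continuous_on ?I ?q" using c by (intro continuous_intros)
  have le: "2 * (?q t \<bullet> m) - m \<bullet> m \<le> (norm (?q t))\<^sup>2" for t
    using zero_le_power2[of "norm (?q t - m)"] unfolding power2_norm_eq_inner
    by (simp only: inner_diff_left[of _ m] inner_diff_right[of _ _ m] inner_commute[of m "?q t"])
  have qm: "integral ?I (\<lambda>t. ?q t \<bullet> m) = 2 * pi * (m \<bullet> m)"
    using integral_linear[OF integrable_continuous_interval[OF cq] bounded_linear_inner_left[of m]]
    by (simp add: o_def m)
  have "integral ?I (\<lambda>t. 2 * (?q t \<bullet> m) - m \<bullet> m)
      = integral ?I (\<lambda>t. 2 * (?q t \<bullet> m)) - integral ?I (\<lambda>t. m \<bullet> m)"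
    using c by (intro integral_diff integrable_continuous_interval continuous_intros)
  also have "\<dots> = 2 * pi * (m \<bullet> m)" using qm by simp
  finally have "integral ?I (\<lambda>t. 2 * (?q t \<bullet> m) - m \<bullet> m) = 2 * pi * (m \<bullet> m)" .
  moreover have "integral ?I (\<lambda>t. 2 * (?q t \<bullet> m) - m \<bullet> m) \<le> integral ?I (\<lambda>t. (norm (?q t))\<^sup>2)"
    using c by (intro integral_le le integrable_continuous_interval continuous_intros)
  ultimately have "2 * pi * (m \<bullet> m) \<le> integral ?I (\<lambda>t. (norm (?q t))\<^sup>2)"
    by simp
  then have "(norm m)\<^sup>2 \<le> 1 / (2 * pi) * integral ?I (\<lambda>t. (norm (?q t))\<^sup>2)"
    by (simp add: field_simps power2_norm_eq_inner)
  then have "ennreal ((norm m)\<^sup>2) \<le> ennreal (1 / (2 * pi)) * ennreal (integral ?I (\<lambda>t. (norm (?q t))\<^sup>2))"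
    by (simp add: ennreal_mult'[symmetric] ennreal_leI)
  also have "ennreal (integral ?I (\<lambda>t. (norm (?q t))\<^sup>2)) = (\<integral>\<^sup>+t. ennreal (indicator ?I t * (norm (?q t))\<^sup>2) \<partial>lborel)"
    using c by (intro nn_integral_has_integral_lebesgue[symmetric] integrable_integral
        integrable_continuous_interval continuous_intros) auto
  also have "\<dots> = (\<integral>\<^sup>+t\<in>?I. ennreal ((norm (?q t))\<^sup>2) \<partial>lborel)"
    by (intro nn_integral_cong) (simp add: indicator_def)
  finally show ?thesis by (simp add: m_def)
qed

text \<open>The pointwise Jensen inequality is integrated over \<open>A\<close>; Tonelli's theorem
  exchanges the integrals, and the bound for each \<open>t\<close> is averaged.\<close>

lemma sqint_diff_screw_average_le:
  fixes u :: "real ^ 3 \<Rightarrow> real ^ 3"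
  assumes u[measurable]: "u \<in> borel_measurable lebesgue" and A[measurable]: "A \<in> sets lebesgue"
    and w: "Cinf w"
    and le: "\<And>t. 0 \<le> t \<Longrightarrow> t \<le> 2 * pi \<Longrightarrow> sqint A (\<lambda>x. u x - screw_field t w x) \<le> D"
  shows "sqint A (\<lambda>x. u x - screw_average w x) \<le> D"
proof -
  interpret L: sigma_finite_measure "lebesgue :: (real ^ 3) measure" by (rule sigma_finite_lebesgue)
  interpret P: pair_sigma_finite lborel "lebesgue :: (real ^ 3) measure" ..
  let ?I = "{0..2 * pi}"
  let ?f = "\<lambda>t x. ennreal ((norm (u x - screw_field t w x))\<^sup>2) * indicator ?I t * indicator A x"
  have F: "(\<lambda>p. screw_field (fst p) w (snd p)) \<in> borel_measurable borel"
    by (intro borel_measurable_continuous_onI Cinf_continuous Cinf_screw_field_joint w)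
  \<comment> \<open>The position variable carries \<open>lebesgue\<close>. This identity map passes
    to the Borel sets of the product, where continuity yields measurability.\<close>
  have p: "(\<lambda>p. (fst p, snd p)) \<in> lborel \<Otimes>\<^sub>M (lebesgue :: (real ^ 3) measure) \<rightarrow>\<^sub>M borel"
    unfolding borel_prod[symmetric]
  proof (rule measurable_Pair)
    show "fst \<in> lborel \<Otimes>\<^sub>M (lebesgue :: (real ^ 3) measure) \<rightarrow>\<^sub>M borel" by measurable
    show "snd \<in> lborel \<Otimes>\<^sub>M (lebesgue :: (real ^ 3) measure) \<rightarrow>\<^sub>M borel"
      using measurable_compose[OF measurable_snd id_borel_measurable_lebesgue] by (simp add: id_def)
  qed
  have [measurable]:
    "(\<lambda>p. screw_field (fst p) w (snd p)) \<in> borel_measurable (lborel \<Otimes>\<^sub>M lebesgue)"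
    using measurable_compose[OF p F] by simp
  have "(\<lambda>p. ?f (fst p) (snd p)) \<in> borel_measurable (lborel \<Otimes>\<^sub>M lebesgue)"
    by measurable
  then have meas[measurable]: "(\<lambda>(t, x). ?f t x) \<in> borel_measurable (lborel \<Otimes>\<^sub>M lebesgue)"
    by (simp add: split_beta)
  have [measurable]: "(\<lambda>x. \<integral>\<^sup>+t. ?f t x \<partial>lborel) \<in> borel_measurable lebesgue"
    using P.Fubini' meas by measurable
  have "sqint A (\<lambda>x. u x - screw_average w x)
      \<le> (\<integral>\<^sup>+x. ennreal (1 / (2 * pi)) * (\<integral>\<^sup>+t. ?f t x \<partial>lborel) \<partial>lebesgue)"
  proof (rule nn_integral_mono)
    fix x
    show "ennreal ((norm (u x - screw_average w x))\<^sup>2) * indicator A x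
      \<le> ennreal (1 / (2 * pi)) * (\<integral>\<^sup>+t. ?f t x \<partial>lborel)"
      using norm_diff_screw_average_le[OF w, of "u x" x] by (simp add: indicator_def)
  qed
  also have "\<dots> = ennreal (1 / (2 * pi)) * (\<integral>\<^sup>+x. \<integral>\<^sup>+t. ?f t x \<partial>lborel \<partial>lebesgue)"
    by (rule nn_integral_cmult) measurable
  also have "(\<integral>\<^sup>+x. \<integral>\<^sup>+t. ?f t x \<partial>lborel \<partial>lebesgue) = (\<integral>\<^sup>+t. \<integral>\<^sup>+x. ?f t x \<partial>lebesgue \<partial>lborel)"
    by (rule P.Fubini'[OF meas])
  also have "\<dots> \<le> (\<integral>\<^sup>+t. D * indicator ?I t \<partial>lborel)"
  proof (rule nn_integral_mono)
    fix t
    show "(\<integral>\<^sup>+x. ?f t x \<partial>lebesgue) \<le> D * indicator ?I t"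
      using le[of t] by (cases "t \<in> ?I") simp_all
  qed
  also have "\<dots> = D * ennreal (2 * pi)"
    by (subst nn_integral_cmult_indicator) simp_all
  also have "ennreal (1 / (2 * pi)) * (D * ennreal (2 * pi)) = D * (ennreal (1 / (2 * pi)) * ennreal (2 * pi))"
    by (simp add: mult_ac)
  also have "ennreal (1 / (2 * pi)) * ennreal (2 * pi) = 1"
    by (simp add: ennreal_mult'[symmetric])
  finally show ?thesis by (simp add: mult_left_mono)
qed

theorem lemma5p1:
  fixes u :: "real ^ 3 \<Rightarrow> real ^ 3" and \<epsilon> :: real
  assumes "u \<in> E2_ring"
    and "helical_distr u"
    and "\<epsilon> > 0"
  shows "\<exists>u\<epsilon>\<in>Cc_inf. divergence_free u\<epsilon> \<and> helical u\<epsilon> \<and>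
           L2uloc_norm (\<lambda>x. u x - u\<epsilon> x) < ennreal \<epsilon>"
proof -
  obtain w where w: "w \<in> Cc_inf" "divergence_free w" "L2uloc_norm (\<lambda>x. u x - w x) < ennreal \<epsilon>"
    using assms(1,3) unfolding E2_ring_def by blast
  have Cw: "Cinf w" using w(1) by (simp add: Cc_inf_def)
  have um[measurable]: "u \<in> borel_measurable lebesgue"
    using assms(1) by (simp add: E2_ring_def L2uloc_def)
  have wm[measurable]: "w \<in> borel_measurable lebesgue" by (rule Cc_inf_measurable[OF w(1)])
  show ?thesis
  \<comment> \<open>A nonzero \<open>w\<close> is needed to build cut-offs; the zero field is
    helical itself and already a valid choice.\<close>
  proof (cases "\<forall>x. w x = 0")
    case True
    then have "helical w" by (simp add: helical_def)
    then show ?thesis using w by blast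
  next
    case False
    then obtain a where a: "w a \<noteq> 0" by blast
    obtain d where d: "0 \<le> d" "d < \<epsilon>" "\<forall>x0. sqint (ball x0 1) (\<lambda>x. u x - w x) \<le> ennreal (d\<^sup>2)"
      using w(3) by (rule L2uloc_norm_less_real)
    have "sqint (ball x0 1) (\<lambda>x. u x - screw_average w x) \<le> ennreal (d\<^sup>2)" for x0
    proof (rule sqint_diff_screw_average_le[OF um _ Cw])
      fix t :: real assume t: "0 \<le> t" "t \<le> 2 * pi"
      have "AE x in lebesgue. screw_field t u x = u x"
        by (rule AE_screw_field_eq[OF assms(1,2) w(1) a t])
      \<comment> \<open>Replacing \<open>u\<close> by its transform almost everywhere makes the
        difference a transform of \<open>u - w\<close>, whose integral over a ball is that of
        \<open>u - w\<close> over the moved ball.\<close>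
      then have "sqint (ball x0 1) (\<lambda>x. u x - screw_field t w x)
          = sqint (ball x0 1) (\<lambda>x. screw_field t u x - screw_field t w x)"
        by (intro nn_integral_cong_AE) (auto elim: eventually_mono)
      also have "\<dots> = sqint (ball x0 1) (screw_field t (\<lambda>x. u x - w x))"
        by (simp add: screw_field_def matrix_vector_mult_diff_distrib)
      also have "\<dots> = sqint (ball (screw t x0) 1) (\<lambda>x. u x - w x)"
        by (rule sqint_ball_screw_field) measurable
      finally show "sqint (ball x0 1) (\<lambda>x. u x - screw_field t w x) \<le> ennreal (d\<^sup>2)"
        using d(3) by simp
    qed simp
    then have "L2uloc_norm (\<lambda>x. u x - screw_average w x) \<le> ennreal d"
      using L2uloc_norm_le_iff[OF d(1)] by blast
    also have "\<dots> < ennreal \<epsilon>" using d by (simp add: ennreal_less_iff)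
    finally show ?thesis
      using screw_average_Cc_inf[OF w(1)] divergence_free_screw_average[OF Cw w(2)]
        helical_screw_average[OF w(1)] by blast
  qed
qed

end
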